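(* Let $f_{i,k}:\mathbb{R}^d\to\mathbb{R}$ ($i\in[N]$, $k\in[M]$) be differentiable, $F_k=\frac1N\sum_{i=1}^N f_{i,k}$, with each $F_k$ bounded below, and suppose assumptions (A1)-(A5) of the context hold with constants $L$ (smoothness), $\sigma^2$ (stochastic gradient variance), $\sigma_g^2$ (heterogeneity), $B>0$ (gradient bound) and $q>0$ (compression). Run the algorithm of the context for $T$ rounds with client learning rate $\eta_l>0$ satisfying $\eta_l\le \frac{1}{2L\tau}$, server learning rate $\eta_g>0$, $\tau\ge 1$ local steps, weight step size $\beta>0$, $|\mathcal{B}^{(t)}|=n$ clients selected in every round, and Gram-estimation client sets of size $n'$. Let $$C_1=\frac{q+1}{n'}\sigma^2+\frac{q B^2}{n'}+\frac{N-n'}{n'(N-1)}\sigma_g^2+B^2 ,$$ which is independent of $T$ and $M$. Then the iterates satisfy $$\frac1T\sum_{t=0}^{T-1}\mathbb{E}\Big\|\sum_{k=1}^M w_k^{(t)}\nabla F_k(x^{(t)})\Big\|^2\le \mathcal{O}\big(\beta M C_1^2\big)+\mathcal{O}\Big(\frac{1}{T\eta_g\eta_l\tau}+\frac{L\eta_g\eta_l\sigma^2}{n}\Big)+\mathcal{O}\big(L\eta_g\eta_l\tau B^2\big)+\mathcal{O}\big(L\eta_l(\tau B^2+\sqrt{\tau}\,B\sigma)\big),$$ where the constants hidden in $\mathcal{O}(\cdot)$ are numerical, except that they may also depend on the initial optimization gap $\delta=\frac1M\sum_{k=1}^M\big(F_k(x^{(0)})-\inf_x F_k(x)\big)$.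
   Context: Setting: $N\ge2$ clients, $M$ objectives, model dimension $d$, $[m]=\{1,\dots,m\}$. $\mathbf F(x)=[F_1(x),\dots,F_M(x)]^\top$ and $\nabla\mathbf F(x)=[\nabla F_1(x),\dots,\nabla F_M(x)]\in\mathbb{R}^{d\times M}$. $\mathcal{W}_M$ is the probability simplex in $\mathbb{R}^M$ and $\mathrm{proj}_{\mathcal{W}_M}$ the Euclidean projection onto it. $\widetilde\nabla f_{i,k}(x)$ denotes a stochastic gradient of $f_{i,k}$ at $x$; $Q$ is a random compression operator on $\mathbb{R}^d$. Assumptions: (A1) $\|\nabla f_{i,k}(x)-\nabla f_{i,k}(x')\|\le L\|x-x'\|$ for all $i,k,x,x'$. (A2) $\mathbb{E}[\widetilde\nabla f_{i,k}(x)]=\nabla f_{i,k}(x)$ and $\mathbb{E}\|\widetilde\nabla f_{i,k}(x)-\nabla f_{i,k}(x)\|^2\le\sigma^2$ for all $i,k,x$. (A3) $\frac1N\sum_{i=1}^N\|\nabla f_{i,k}(x)-\nabla F_k(x)\|^2\le\sigma_g^2$ for all $k,x$. (A4) $\|\nabla f_{i,k}(x)\|\le B$ for all $i,k,x$. (A5) $\mathbb{E}[Q(x)]=x$ and $\mathbb{E}\|Q(x)-x\|^2\le q\|x\|^2$ for all $x\in\mathbb{R}^d$. Algorithm (FedCMOO, in the form analysed). Start from $x^{(0)}\in\mathbb{R}^d$ and $w^{(0)}=(1/M,\dots,1/M)$. In round $t=0,\dots,T-1$: 1. Select a set $\mathcal{B}^{(t)}$ of $n$ clients uniformly at random (without replacement)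 from $[N]$. 2. For $j=1,2$, sample independently a set $\mathcal{A}^{(t)}_j$ of $n'$ clients uniformly at random (without replacement); each $i\in\mathcal{A}_j^{(t)}$ draws fresh stochastic gradients $\widetilde\nabla f_{i,k}(x^{(t)},\xi_j)$, $k\in[M]$, and sends $Q(\widetilde\nabla f_{i,k}(x^{(t)},\xi_j))$. Put $Y_j^{(t)}=\frac1{n'}\sum_{i\in\mathcal{A}^{(t)}_j}[Q(\widetilde\nabla f_{i,1}(x^{(t)},\xi_j)),\dots,Q(\widetilde\nabla f_{i,M}(x^{(t)},\xi_j))]\in\mathbb{R}^{d\times M}$ and $G^{(t)}=(Y_1^{(t)})^\top Y_2^{(t)}$. 3. $w^{(t+1)}=\mathrm{proj}_{\mathcal{W}_M}\big(w^{(t)}-\beta G^{(t)}w^{(t)}\big)$. 4. Each $i\in\mathcal{B}^{(t)}$ sets $x_i^{(t,0)}=x^{(t)}$ and, for $r=0,\dots,\tau-1$, $x_i^{(t,r+1)}=x_i^{(t,r)}-\eta_l\sum_{k=1}^M w_k^{(t+1)}\widetilde\nabla f_{i,k}(x_i^{(t,r)})$; then $\Delta_i^{(t)}=\frac{1}{\tau\eta_l}(x^{(t)}-x_i^{(t,\tau)})$. 5. $x^{(t+1)}=x^{(t)}-\eta_g\eta_l\tau\frac1n\sum_{i\in\mathcal{B}^{(t)}}\Delta_i^{(t)}$. The client samplings, the stochastic gradient draws (across clients, local steps, rounds, and between the two Gram-estimation sets and local training) and the compression randomness are mutually independent; conditional on the past, (A2) and (A5) hold at the (random) points where they are applied. 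*)

theory Defs
  imports "HOL-Probability.Probability"
begin

text \<open>
  Clients are the elements of a finite type \<open>'n\<close> (so \<open>N = CARD('n)\<close>), objectives those of a finite
  type \<open>'m\<close> (so \<open>M = CARD('m)\<close>), and the model space is a Euclidean space \<open>'a\<close> (so \<open>d = DIM('a)\<close>).
  A \<open>d \<times> M\<close> matrix is the vector of its columns, of type \<open>'a ^ 'm\<close>.

  The stochastic gradient of \<open>f i k\<close> at \<open>x\<close> is \<open>g i k x s\<close> with \<open>s\<close> drawn from the probability space
  \<open>D i\<close> of client \<open>i\<close>; one draw serves all objectives, so that no assumption is made on their joint
  law.  The compression of \<open>v\<close> is \<open>Q v c\<close> with \<open>c\<close> drawn from \<open>C\<close>.
\<close>

subsection \<open>Objectives\<close>

definition grad :: "('a::real_inner \<Rightarrow> real) \<Rightarrow> 'a \<Rightarrow> 'a" where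
  "grad f x = (THE v. GDERIV f x :> v)"

definition global_obj :: "('n::finite \<Rightarrow> 'm \<Rightarrow> 'a \<Rightarrow> real) \<Rightarrow> 'm \<Rightarrow> 'a \<Rightarrow> real" where
  "global_obj f k x = (1 / real CARD('n)) * (\<Sum>i\<in>UNIV. f i k x)"

definition opt_gap :: "('n::finite \<Rightarrow> 'm::finite \<Rightarrow> 'a \<Rightarrow> real) \<Rightarrow> 'a \<Rightarrow> real" where
  "opt_gap f x0 =
     (1 / real CARD('m)) * (\<Sum>k\<in>UNIV. global_obj f k x0 - (INF x. global_obj f k x))"

definition prob_simplex :: "(real ^ 'm::finite) set" where
  "prob_simplex = {w. (\<forall>k. 0 \<le> w $ k) \<and> (\<Sum>k\<in>UNIV. w $ k) = 1}"

subsection \<open>Randomness\<close>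

definition client_sampling :: "nat \<Rightarrow> ('n::finite set) measure" where
  "client_sampling b = measure_pmf (pmf_of_set {B. card B = b})"

text \<open>
  Mutual independence is expressed by product measures.  Seeds are drawn for every client;
  those of clients that are not selected are never used.
\<close>

type_synonym ('n, 'm, 's, 'c) gram_seed = "'n set \<times> ('n \<Rightarrow> 's) \<times> ('n \<times> 'm \<Rightarrow> 'c)"

definition gram_space ::
  "('n::finite \<Rightarrow> 's measure) \<Rightarrow> 'c measure \<Rightarrow> nat \<Rightarrow> ('n, 'm::finite, 's, 'c) gram_seed measure" where
  "gram_space D C n' =
     client_sampling n' \<Otimes>\<^sub>M (PiM UNIV D \<Otimes>\<^sub>M PiM UNIV (\<lambda>_. C))"

type_synonym ('n, 'm, 's, 'c) round_seed =
  "('n, 'm, 's, 'c) gram_seed \<times> ('n, 'm, 's, 'c) gram_seed \<times> 'n set \<times> (nat \<Rightarrow> 'n \<Rightarrow> 's)"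

definition round_space ::
  "('n::finite \<Rightarrow> 's measure) \<Rightarrow> 'c measure \<Rightarrow> nat \<Rightarrow> nat \<Rightarrow> nat
     \<Rightarrow> ('n, 'm::finite, 's, 'c) round_seed measure" where
  "round_space D C n n' \<tau> =
     gram_space D C n' \<Otimes>\<^sub>M (gram_space D C n' \<Otimes>\<^sub>M
       (client_sampling n \<Otimes>\<^sub>M PiM {..<\<tau>} (\<lambda>_. PiM UNIV D)))"

definition run_space ::
  "('n::finite \<Rightarrow> 's measure) \<Rightarrow> 'c measure \<Rightarrow> nat \<Rightarrow> nat \<Rightarrow> nat \<Rightarrow> nat
     \<Rightarrow> (nat \<Rightarrow> ('n, 'm::finite, 's, 'c) round_seed) measure" where
  "run_space D C n n' \<tau> T = PiM {..<T} (\<lambda>_. round_space D C n n' \<tau>)"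

subsection \<open>The algorithm\<close>

definition gram_sketch ::
  "('n \<Rightarrow> 'm \<Rightarrow> 'a \<Rightarrow> 's \<Rightarrow> 'a) \<Rightarrow> ('a \<Rightarrow> 'c \<Rightarrow> 'a) \<Rightarrow> nat \<Rightarrow> 'a
     \<Rightarrow> ('n, 'm, 's, 'c) gram_seed \<Rightarrow> 'a::euclidean_space ^ 'm::finite" where
  "gram_sketch g Q n' x = (\<lambda>(A, \<xi>, c).
     (\<chi> k. (1 / real n') *\<^sub>R (\<Sum>i\<in>A. Q (g i k x (\<xi> i)) (c (i, k)))))"

text \<open>The matrix product \<open>(Y\<^sub>1)\<^sup>T Y\<^sub>2\<close> in terms of columns.\<close>

definition gram_mat :: "'a::euclidean_space ^ 'm::finite \<Rightarrow> 'a ^ 'm \<Rightarrow> real ^ 'm ^ 'm" where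
  "gram_mat Y\<^sub>1 Y\<^sub>2 = (\<chi> k l. (Y\<^sub>1 $ k) \<bullet> (Y\<^sub>2 $ l))"

definition weight_update :: "real \<Rightarrow> real ^ 'm ^ 'm \<Rightarrow> real ^ 'm::finite \<Rightarrow> real ^ 'm" where
  "weight_update \<beta> G w = closest_point prob_simplex (w - \<beta> *\<^sub>R (G *v w))"

primrec local_iter ::
  "('n \<Rightarrow> 'm::finite \<Rightarrow> 'a \<Rightarrow> 's \<Rightarrow> 'a) \<Rightarrow> real \<Rightarrow> 'a::euclidean_space \<Rightarrow> real ^ 'm
     \<Rightarrow> 'n \<Rightarrow> (nat \<Rightarrow> 'n \<Rightarrow> 's) \<Rightarrow> nat \<Rightarrow> 'a" where
  "local_iter g \<eta>\<^sub>l x w i \<zeta> 0 = x"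
| "local_iter g \<eta>\<^sub>l x w i \<zeta> (Suc r) =
     local_iter g \<eta>\<^sub>l x w i \<zeta> r
       - \<eta>\<^sub>l *\<^sub>R (\<Sum>k\<in>UNIV. w $ k *\<^sub>R g i k (local_iter g \<eta>\<^sub>l x w i \<zeta> r) (\<zeta> r i))"

definition local_delta ::
  "('n \<Rightarrow> 'm::finite \<Rightarrow> 'a \<Rightarrow> 's \<Rightarrow> 'a) \<Rightarrow> real \<Rightarrow> nat \<Rightarrow> 'a::euclidean_space \<Rightarrow> real ^ 'm
     \<Rightarrow> 'n \<Rightarrow> (nat \<Rightarrow> 'n \<Rightarrow> 's) \<Rightarrow> 'a" where
  "local_delta g \<eta>\<^sub>l \<tau> x w i \<zeta> =
     (1 / (real \<tau> * \<eta>\<^sub>l)) *\<^sub>R (x - local_iter g \<eta>\<^sub>l x w i \<zeta> \<tau>)"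

definition fedcmoo_round ::
  "('n \<Rightarrow> 'm::finite \<Rightarrow> 'a \<Rightarrow> 's \<Rightarrow> 'a) \<Rightarrow> ('a \<Rightarrow> 'c \<Rightarrow> 'a)
     \<Rightarrow> nat \<Rightarrow> nat \<Rightarrow> nat \<Rightarrow> real \<Rightarrow> real \<Rightarrow> real \<Rightarrow> ('n, 'm, 's, 'c) round_seed
     \<Rightarrow> 'a::euclidean_space \<times> (real ^ 'm) \<Rightarrow> 'a \<times> (real ^ 'm)" where
  "fedcmoo_round g Q n n' \<tau> \<beta> \<eta>\<^sub>l \<eta>\<^sub>g = (\<lambda>(s\<^sub>1, s\<^sub>2, B, \<zeta>) (x, w).
     let G = gram_mat (gram_sketch g Q n' x s\<^sub>1) (gram_sketch g Q n' x s\<^sub>2);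
         w' = weight_update \<beta> G w;
         x' = x - (\<eta>\<^sub>g * \<eta>\<^sub>l * real \<tau>) *\<^sub>R
                    ((1 / real n) *\<^sub>R (\<Sum>i\<in>B. local_delta g \<eta>\<^sub>l \<tau> x w' i \<zeta>))
     in (x', w'))"

primrec fedcmoo ::
  "('n \<Rightarrow> 'm::finite \<Rightarrow> 'a \<Rightarrow> 's \<Rightarrow> 'a) \<Rightarrow> ('a \<Rightarrow> 'c \<Rightarrow> 'a)
     \<Rightarrow> nat \<Rightarrow> nat \<Rightarrow> nat \<Rightarrow> real \<Rightarrow> real \<Rightarrow> real \<Rightarrow> 'a::euclidean_space
     \<Rightarrow> (nat \<Rightarrow> ('n, 'm, 's, 'c) round_seed) \<Rightarrow> nat \<Rightarrow> 'a \<times> (real ^ 'm)" where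
  "fedcmoo g Q n n' \<tau> \<beta> \<eta>\<^sub>l \<eta>\<^sub>g x0 \<omega> 0 = (x0, (\<chi> k. 1 / real CARD('m)))"
| "fedcmoo g Q n n' \<tau> \<beta> \<eta>\<^sub>l \<eta>\<^sub>g x0 \<omega> (Suc t) =
     fedcmoo_round g Q n n' \<tau> \<beta> \<eta>\<^sub>l \<eta>\<^sub>g (\<omega> t) (fedcmoo g Q n n' \<tau> \<beta> \<eta>\<^sub>l \<eta>\<^sub>g x0 \<omega> t)"

subsection \<open>The constants of the bound\<close>

definition C1_const :: "nat \<Rightarrow> nat \<Rightarrow> real \<Rightarrow> real \<Rightarrow> real \<Rightarrow> real \<Rightarrow> real" where
  "C1_const N n' q \<sigma> \<sigma>\<^sub>g B =
     (q + 1) / real n' * \<sigma>\<^sup>2 + q * B\<^sup>2 / real n'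
       + (real N - real n') / (real n' * (real N - 1)) * \<sigma>\<^sub>g\<^sup>2 + B\<^sup>2"

text \<open>
  The constant hidden in each \<open>\<O>(\<dots>)\<close>: it may depend on the initial optimization gap \<open>\<delta>\<close> and on
  nothing else.  In a theorem with type parameters, an existentially quantified constant could depend
  on the types, that is on \<open>d\<close>, \<open>M\<close>, \<open>N\<close> and the seed spaces; a closed expression in \<open>\<delta>\<close>
  rules this out.  The particular value is immaterial and not optimized.
\<close>

definition O_const :: "real \<Rightarrow> real" where
  "O_const \<delta> = 10 * (1 + \<delta>)"

end

theory Submission
  imports Defs
begin

text \<open>
  With \<open>u\<close> the uniform weight and \<open>\<eta> = \<eta>\<^sub>g \<eta>\<^sub>l \<tau>\<close>, the potential
  \<open>opt_gap f x / \<eta> + \<bar>w - u\<bar>\<^sup>2 / (2 \<beta>)\<close> decreases in one round by \<open>\<bar>J w\<bar>\<^sup>2\<close> in expectation, up to an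
  additive error, where \<open>J\<close> has the columns \<open>grad (global_obj f k) x\<close>.  The descent lemma for the
  uniformly weighted objective yields \<open>- J u \<bullet> J w'\<close> for the new weights \<open>w'\<close>, and \<open>w'\<close> is replaced by
  \<open>w\<close> at a cost of order \<open>\<beta>\<close>, as projections do not increase distances.  As the Gram estimate is
  unbiased, the projected step yields \<open>- J (w - u) \<bullet> J w\<close>; the two terms add up to \<open>- \<bar>J w\<bar>\<^sup>2\<close>.
  The algorithm starts at \<open>w = u\<close>, so telescoping leaves only the initial gap and the errors.
\<close>

subsection \<open>Mean-zero vectors with bounded variance\<close>

text \<open>The obstacle is correlation: the new weights depend on both sketches, and later local
  iterates depend on earlier local noise. Each round is therefore integrated from the inside out:
  the local seeds with clients and weights fixed, then the client set, then the second sketch, then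
  the first. As the two sketches are independent, bilinear terms in them average to products of
  means, and \<open>norm (G *v w)\<close> has second moment at most
  \<open>CARD('m) * C\<^sub>1\<^sup>2\<close>: the unweighted sum over rows costs the factor
  \<open>CARD('m)\<close>, the convex combination over columns costs nothing. The price of replacing
  new weights by old ones is bounded pathwise, before the sketches are averaged. No integrability of
  the potential is available in advance. Being nonnegative, it is only ever integrated as an
  \<open>ennreal\<close>; signed terms occur only inside integrable upper bounds, whose total stays
  nonnegative at every level.\<close>

text \<open>Over a probability space, expanding the square shows that the inequality for all shifts
  \<open>a\<close> encodes mean zero and second moment at most \<open>v\<close> at once. In this
  form it passes through iterated nonnegative integrals: whatever has been accumulated from other
  coordinates plays the role of \<open>a\<close>.\<close>

definition centered :: "'b measure \<Rightarrow> ('b \<Rightarrow> 'a::euclidean_space) \<Rightarrow> real \<Rightarrow> bool" where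
  "centered M S v \<longleftrightarrow> 0 \<le> v \<and> S \<in> borel_measurable M \<and>
     (\<forall>a. (\<integral>\<^sup>+x. ennreal ((norm (a + S x))\<^sup>2) \<partial>M) \<le> ennreal ((norm a)\<^sup>2 + v))"

lemma centered_nn_integral:
  "centered M S v \<Longrightarrow> (\<integral>\<^sup>+x. ennreal ((norm (a + S x))\<^sup>2) \<partial>M) \<le> ennreal ((norm a)\<^sup>2 + v)"
  unfolding centered_def by blast

lemma norm_add_sq: "(norm (a + b))\<^sup>2 = (norm a)\<^sup>2 + 2 * (a \<bullet> b) + (norm b)\<^sup>2" for a b :: "'a::real_inner"
  by (simp add: power2_norm_eq_inner inner_commute algebra_simps)

lemma le_one_plus_sq: "t \<le> 1 + t\<^sup>2" for t :: real
proof -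
  have "0 \<le> (t - 1)\<^sup>2 + t\<^sup>2 + 1" by simp
  then show ?thesis by (simp add: power2_diff)
qed

lemma (in prob_space) integrable_of_square:
  fixes S :: "'a \<Rightarrow> 'b::euclidean_space"
  assumes [measurable]: "S \<in> borel_measurable M" and "integrable M (\<lambda>x. (norm (S x))\<^sup>2)"
  shows "integrable M S"
proof (rule Bochner_Integration.integrable_bound)
  show "integrable M (\<lambda>x. 1 + (norm (S x))\<^sup>2)" using assms by simp
  show "AE x in M. norm (S x) \<le> norm (1 + (norm (S x))\<^sup>2)"
    using le_one_plus_sq by (auto intro!: AE_I2 order.trans[OF le_one_plus_sq])
qed simp

lemma (in prob_space) centeredI:
  fixes S :: "'a \<Rightarrow> 'b::euclidean_space"
  assumes S: "integrable M S" "(\<integral>x. S x \<partial>M) = 0"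
    and sq: "integrable M (\<lambda>x. (norm (S x))\<^sup>2)" "(\<integral>x. (norm (S x))\<^sup>2 \<partial>M) \<le> v"
  shows "centered M S v"
proof -
  have "0 \<le> (\<integral>x. (norm (S x))\<^sup>2 \<partial>M)" by simp
  then have v: "0 \<le> v" using sq by linarith
  have "(\<integral>\<^sup>+x. ennreal ((norm (a + S x))\<^sup>2) \<partial>M) \<le> ennreal ((norm a)\<^sup>2 + v)" for a
  proof -
    have "(\<integral>\<^sup>+x. ennreal ((norm (a + S x))\<^sup>2) \<partial>M)
      = ennreal (\<integral>x. (norm a)\<^sup>2 + 2 * (a \<bullet> S x) + (norm (S x))\<^sup>2 \<partial>M)"
    proof (subst nn_integral_eq_integral)
      show "integrable M (\<lambda>x. (norm (a + S x))\<^sup>2)" using S sq by (simp add: norm_add_sq)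
    qed (simp_all only: norm_add_sq[symmetric], simp)
    also have "(\<integral>x. (norm a)\<^sup>2 + 2 * (a \<bullet> S x) + (norm (S x))\<^sup>2 \<partial>M)
      = (norm a)\<^sup>2 + 2 * (a \<bullet> (\<integral>x. S x \<partial>M)) + (\<integral>x. (norm (S x))\<^sup>2 \<partial>M)"
      using S(1) sq(1) by (simp add: prob_space)
    also have "\<dots> \<le> (norm a)\<^sup>2 + v" using S sq by simp
    finally show ?thesis by (simp add: ennreal_leI)
  qed
  then show ?thesis using S v by (auto simp: centered_def)
qed

text \<open>Letting the shift \<open>a\<close> grow in \<open>2 a \<bullet> E S + E \<bar>S\<bar>\<^sup>2 \<le> v\<close> forces the mean to vanish.\<close>

lemma (in prob_space) centeredD:
  fixes S :: "'a \<Rightarrow> 'b::euclidean_space"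
  assumes c: "centered M S v"
  shows "integrable M (\<lambda>x. (norm (S x))\<^sup>2)" "(\<integral>x. (norm (S x))\<^sup>2 \<partial>M) \<le> v"
    "integrable M S" "(\<integral>x. S x \<partial>M) = 0"
proof -
  have [measurable]: "S \<in> borel_measurable M" and v: "0 \<le> v" using c by (auto simp: centered_def)
  have nn: "(\<integral>\<^sup>+x. ennreal ((norm (S x))\<^sup>2) \<partial>M) \<le> ennreal v"
    using centered_nn_integral[OF c, of 0] by simp
  show sq: "integrable M (\<lambda>x. (norm (S x))\<^sup>2)"
    using nn by (intro integrableI_bounded) (auto simp: less_top[symmetric] top_unique)
  show "(\<integral>x. (norm (S x))\<^sup>2 \<partial>M) \<le> v"
    using nn v by (subst (asm) nn_integral_eq_integral[OF sq]) auto
  show int: "integrable M S" by (rule integrable_of_square[OF _ sq]) simp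
  let ?m = "\<integral>x. S x \<partial>M"
  have *: "2 * (a \<bullet> ?m) \<le> v" for a
  proof -
    have e: "(\<integral>x. (norm (a + S x))\<^sup>2 \<partial>M) = (norm a)\<^sup>2 + 2 * (a \<bullet> ?m) + (\<integral>x. (norm (S x))\<^sup>2 \<partial>M)"
      using int sq by (simp add: norm_add_sq prob_space)
    have "integrable M (\<lambda>x. (norm (a + S x))\<^sup>2)" using int sq by (simp add: norm_add_sq)
    from nn_integral_eq_integral[OF this] centered_nn_integral[OF c, of a]
    have "(\<integral>x. (norm (a + S x))\<^sup>2 \<partial>M) \<le> (norm a)\<^sup>2 + v" using v by (simp del: ennreal_plus)
    moreover have "0 \<le> (\<integral>x. (norm (S x))\<^sup>2 \<partial>M)" by simp
    ultimately show ?thesis using e by linarith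
  qed
  show "?m = 0"
  proof (rule ccontr)
    assume "?m \<noteq> 0"
    then have "?m \<bullet> ?m > 0" by simp
    then have "((v + 1) / (?m \<bullet> ?m)) *\<^sub>R ?m \<bullet> ?m = v + 1" by simp
    then have "2 * (v + 1) \<le> v" using *[of "((v + 1) / (?m \<bullet> ?m)) *\<^sub>R ?m"] by metis
    with v show False by simp
  qed
qed

text \<open>The variance of the real variable \<open>norm (S x)\<close> is nonnegative, so its
  squared mean is at most its second moment. This serves the terms in which local noise enters
  linearly.\<close>

lemma (in prob_space) centered_norm_le:
  fixes S :: "'a \<Rightarrow> 'b::euclidean_space"
  assumes c: "centered M S v"
  shows "integrable M (\<lambda>x. norm (S x))" "(\<integral>x. norm (S x) \<partial>M) \<le> sqrt v"
proof -
  note d = centeredD[OF c]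
  show i: "integrable M (\<lambda>x. norm (S x))" using d by simp
  let ?m = "\<integral>x. norm (S x) \<partial>M"
  have "0 \<le> (\<integral>x. (norm (S x) - ?m)\<^sup>2 \<partial>M)" by simp
  also have "\<dots> = (\<integral>x. (norm (S x))\<^sup>2 - 2 * ?m * norm (S x) + ?m\<^sup>2 \<partial>M)"
    by (rule Bochner_Integration.integral_cong) (auto simp: power2_eq_square algebra_simps)
  also have "\<dots> = (\<integral>x. (norm (S x))\<^sup>2 \<partial>M) - ?m\<^sup>2"
    using i d by (simp add: prob_space power2_eq_square)
  finally show "?m \<le> sqrt v" using d(2) by (intro real_le_rsqrt) linarith
qed

lemma (in prob_space) centered_0: "0 \<le> v \<Longrightarrow> centered M (\<lambda>x. 0 :: 'b::euclidean_space) v"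
  by (rule centeredI) auto

lemma centered_scale:
  fixes S :: "'b \<Rightarrow> 'a::euclidean_space"
  assumes "prob_space M" "centered M S v"
  shows "centered M (\<lambda>x. c *\<^sub>R S x) (c\<^sup>2 * v)"
proof -
  interpret prob_space M by fact
  note d = centeredD[OF assms(2)]
  show ?thesis
    by (rule centeredI) (use d in \<open>auto simp: power_mult_distrib intro!: mult_left_mono\<close>)
qed

lemma centered_mono: "centered M S v \<Longrightarrow> v \<le> v' \<Longrightarrow> centered M S v'"
  unfolding centered_def by (meson add_left_mono ennreal_leI order_trans)

section \<open>Independent sums and adapted processes on product spaces\<close>

lemma product_sigma_finite_prob:
  "(\<And>i. prob_space (M i)) \<Longrightarrow> product_sigma_finite M"
  by (simp add: product_sigma_finite_def prob_space_imp_sigma_finite)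

lemma prob_space_PiM': "(\<And>i. prob_space (M i)) \<Longrightarrow> prob_space (PiM I M)"
  by (rule prob_space_PiM) auto

text \<open>Variances of independent centered vectors add. The coordinate added by the induction is
  integrated first, with \<open>a\<close> plus the sum over the old coordinates as its
  shift.\<close>

lemma centered_sum_PiM:
  fixes Z :: "'i \<Rightarrow> 'b \<Rightarrow> 'a::euclidean_space"
  assumes P: "\<And>i. prob_space (M i)" and "finite I"
    and c: "\<And>i. i \<in> I \<Longrightarrow> centered (M i) (Z i) (v i)"
  shows "centered (PiM I M) (\<lambda>w. \<Sum>i\<in>I. Z i (w i)) (\<Sum>i\<in>I. v i)"
proof -
  have [measurable]: "i \<in> I \<Longrightarrow> Z i \<in> borel_measurable (M i)" and v: "i \<in> I \<Longrightarrow> 0 \<le> v i" for i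
    using c by (auto simp: centered_def)
  have "(\<integral>\<^sup>+w. ennreal ((norm (a + (\<Sum>i\<in>I. Z i (w i))))\<^sup>2) \<partial>PiM I M)
        \<le> ennreal ((norm a)\<^sup>2 + (\<Sum>i\<in>I. v i))" for a
    using \<open>finite I\<close> c
  proof (induction I)
    case empty
    interpret product_sigma_finite M by (rule product_sigma_finite_prob) (rule P)
    show ?case by (simp add: nn_integral_empty del: nn_integral_const)
  next
    case (insert i I)
    interpret product_sigma_finite M by (rule product_sigma_finite_prob) (rule P)
    have [measurable]: "j \<in> insert i I \<Longrightarrow> Z j \<in> borel_measurable (M j)" for j
      using insert.prems by (auto simp: centered_def)
    have v: "0 \<le> v i" "0 \<le> (\<Sum>i\<in>I. v i)"
      using insert.prems by (auto simp: centered_def intro!: sum_nonneg)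
    have "(\<integral>\<^sup>+w. ennreal ((norm (a + (\<Sum>j\<in>insert i I. Z j (w j))))\<^sup>2) \<partial>PiM (insert i I) M)
      = (\<integral>\<^sup>+w. (\<integral>\<^sup>+y. ennreal ((norm (a + (\<Sum>j\<in>insert i I. Z j ((w(i := y)) j))))\<^sup>2) \<partial>M i) \<partial>PiM I M)"
      using insert.hyps by (intro product_nn_integral_insert) auto
    also have "\<dots> = (\<integral>\<^sup>+w. (\<integral>\<^sup>+y. ennreal ((norm ((a + (\<Sum>j\<in>I. Z j (w j))) + Z i y))\<^sup>2) \<partial>M i) \<partial>PiM I M)"
    proof -
      have "(\<Sum>j\<in>insert i I. Z j ((w(i := y)) j)) = (\<Sum>j\<in>I. Z j (w j)) + Z i y" for w y
      proof -
        have "(\<Sum>j\<in>I. Z j ((w(i := y)) j)) = (\<Sum>j\<in>I. Z j (w j))"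
          using insert.hyps by (intro sum.cong) auto
        then show ?thesis using insert.hyps by (simp add: add.commute)
      qed
      then show ?thesis by (simp add: add.assoc)
    qed
    also have "\<dots> \<le> (\<integral>\<^sup>+w. ennreal ((norm (a + (\<Sum>j\<in>I. Z j (w j))))\<^sup>2 + v i) \<partial>PiM I M)"
      by (intro nn_integral_mono centered_nn_integral) (use insert.prems in auto)
    also have "\<dots> = (\<integral>\<^sup>+w. ennreal ((norm (a + (\<Sum>j\<in>I. Z j (w j))))\<^sup>2) \<partial>PiM I M) + ennreal (v i)"
      using v by (simp add: nn_integral_add prob_space.emeasure_space_1 prob_space_PiM' P)
    also have "\<dots> \<le> ennreal ((norm a)\<^sup>2 + (\<Sum>i\<in>I. v i)) + ennreal (v i)"
      using insert by (intro add_mono) auto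
    also have "\<dots> = ennreal ((norm a)\<^sup>2 + (\<Sum>i\<in>insert i I. v i))"
      using insert.hyps v by (simp add: ennreal_plus[symmetric] algebra_simps del: ennreal_plus)
    finally show ?case .
  qed
  then show ?thesis using v by (auto simp: centered_def intro!: sum_nonneg)
qed

text \<open>Seeds exist for all clients while only the selected ones are read; the unread
  coordinates are padded with the zero variable of variance 0.\<close>

lemma centered_sum_PiM_subset:
  fixes Z :: "'i \<Rightarrow> 'b \<Rightarrow> 'a::euclidean_space"
  assumes P: "\<And>i. prob_space (M i)" and I: "finite I" "J \<subseteq> I"
    and c: "\<And>i. i \<in> J \<Longrightarrow> centered (M i) (Z i) (v i)"
  shows "centered (PiM I M) (\<lambda>\<omega>. \<Sum>i\<in>J. Z i (\<omega> i)) (\<Sum>i\<in>J. v i)"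
proof -
  let ?Z = "\<lambda>i y. if i \<in> J then Z i y else 0" and ?v = "\<lambda>i. if i \<in> J then v i else 0"
  have "centered (M i) (?Z i) (?v i)" for i
    using c[of i] prob_space.centered_0[OF P, of 0] by (cases "i \<in> J") auto
  then have "centered (PiM I M) (\<lambda>\<omega>. \<Sum>i\<in>I. ?Z i (\<omega> i)) (\<Sum>i\<in>I. ?v i)"
    by (intro centered_sum_PiM P I)
  then show ?thesis using I by (simp add: sum.inter_restrict[symmetric] Int_absorb1)
qed

text \<open>A telescoped supermartingale estimate: \<open>V t\<close> and \<open>h t\<close> read
  only coordinates below \<open>t\<close>, and integrating coordinate \<open>t\<close> lowers
  \<open>V\<close> by \<open>h t\<close> up to \<open>c\<close>. Keeping \<open>h\<close> on the
  left avoids subtraction in \<open>ennreal\<close>. It serves twice: for the potential over the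
  rounds, and with \<open>h = 0\<close> for the local noise over the local steps. The induction is
  on the number of coordinates, whence measurability for every \<open>T\<close>;
  \<open>\<lambda>_. undefined\<close> is the only point of the empty product.\<close>

lemma nn_integral_PiM_drift:
  fixes V h :: "nat \<Rightarrow> (nat \<Rightarrow> 'r) \<Rightarrow> ennreal"
  assumes M: "prob_space M"
    and meas: "\<And>t T. t \<le> T \<Longrightarrow> V t \<in> borel_measurable (PiM {..<T} (\<lambda>_. M))"
      "\<And>t T. t \<le> T \<Longrightarrow> h t \<in> borel_measurable (PiM {..<T} (\<lambda>_. M))"
    and adapted: "\<And>t i w y. t \<le> i \<Longrightarrow> V t (w(i := y)) = V t w"
      "\<And>t i w y. t \<le> i \<Longrightarrow> h t (w(i := y)) = h t w"
    and drift: "\<And>t w. (\<integral>\<^sup>+y. V (Suc t) (w(t := y)) \<partial>M) + h t w \<le> V t w + c"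
    and "t \<le> T"
  shows "(\<integral>\<^sup>+w. V t w + (\<Sum>j<t. h j w) \<partial>PiM {..<T} (\<lambda>_. M)) \<le> V 0 (\<lambda>_. undefined) + of_nat t * c"
  using \<open>t \<le> T\<close>
proof (induction T arbitrary: t)
  case 0
  interpret product_sigma_finite "\<lambda>_::nat. M" by (rule product_sigma_finite_prob) (rule M)
  show ?case using 0 by (simp add: nn_integral_empty)
next
  case (Suc T)
  interpret product_sigma_finite "\<lambda>_::nat. M" by (rule product_sigma_finite_prob) (rule M)
  have m[measurable]: "V j \<in> borel_measurable (PiM {..<T} (\<lambda>_. M))"
    "h j \<in> borel_measurable (PiM {..<T} (\<lambda>_. M))" if "j \<le> T" for j
    using that meas by auto
  have *: "(\<integral>\<^sup>+w. V t w + (\<Sum>j<t. h j w) \<partial>PiM {..<Suc T} (\<lambda>_. M))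
    = (\<integral>\<^sup>+w. (\<integral>\<^sup>+y. V t (w(T := y)) + (\<Sum>j<t. h j (w(T := y))) \<partial>M) \<partial>PiM {..<T} (\<lambda>_. M))"
    unfolding lessThan_Suc using Suc.prems
    by (intro product_nn_integral_insert)
      (auto intro!: borel_measurable_add borel_measurable_sum meas simp: lessThan_Suc[symmetric])
  show ?case
  \<comment> \<open>Either the last coordinate is read by no term and integrates out, or
    \<open>t = Suc T\<close> and exactly one application of the drift is due.\<close>
  proof (cases "t \<le> T")
    case True
    then show ?thesis unfolding *
      using Suc.IH[OF True] by (simp add: adapted prob_space.emeasure_space_1[OF M])
  next
    case False
    then have t: "t = Suc T" using Suc.prems by simp
    have "(\<integral>\<^sup>+y. V t (w(T := y)) + (\<Sum>j<t. h j (w(T := y))) \<partial>M) \<le> V T w + (\<Sum>j<T. h j w) + c"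
      if [measurable]: "w \<in> space (PiM {..<T} (\<lambda>_. M))" for w
    proof -
      have [measurable]: "(\<lambda>y. V (Suc T) (w(T := y))) \<in> borel_measurable M"
      proof (rule measurable_compose[OF _ meas(1)[OF order_refl]])
        show "(\<lambda>y. w(T := y)) \<in> measurable M (PiM {..<Suc T} (\<lambda>_. M))"
          unfolding lessThan_Suc by (rule measurable_fun_upd[where J="{..<T}"]) auto
      qed
      have "(\<integral>\<^sup>+y. V t (w(T := y)) + (\<Sum>j<t. h j (w(T := y))) \<partial>M)
        = (\<integral>\<^sup>+y. V (Suc T) (w(T := y)) + (\<Sum>j<Suc T. h j w) \<partial>M)"
        unfolding t by (intro nn_integral_cong arg_cong2[where f="(+)"] sum.cong) (auto simp: adapted)
      also have "\<dots> = (\<integral>\<^sup>+y. V (Suc T) (w(T := y)) \<partial>M) + (\<Sum>j<Suc T. h j w)"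
        by (simp add: nn_integral_add prob_space.emeasure_space_1[OF M])
      also have "\<dots> \<le> V T w + (\<Sum>j<T. h j w) + c"
        using add_right_mono[OF drift[of T w], of "\<Sum>j<T. h j w"] by (simp add: ac_simps)
      finally show ?thesis .
    qed
    then have "(\<integral>\<^sup>+w. V t w + (\<Sum>j<t. h j w) \<partial>PiM {..<Suc T} (\<lambda>_. M))
      \<le> (\<integral>\<^sup>+w. V T w + (\<Sum>j<T. h j w) + c \<partial>PiM {..<T} (\<lambda>_. M))"
      unfolding * by (rule nn_integral_mono)
    also have "\<dots> = (\<integral>\<^sup>+w. V T w + (\<Sum>j<T. h j w) \<partial>PiM {..<T} (\<lambda>_. M)) + c"
      by (subst nn_integral_add) (auto simp: prob_space.emeasure_space_1 prob_space_PiM' M)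
    also have "\<dots> \<le> V 0 (\<lambda>_. undefined) + of_nat T * c + c"
      by (intro add_right_mono Suc.IH) simp
    finally show ?thesis by (simp add: t algebra_simps)
  qed
qed

text \<open>The bridge from signed bounds to nonnegative integrals. \<open>ennreal\<close> truncates
  negative numbers, so nonnegativity of \<open>G\<close> must be known before its integral may be
  taken outside; it is also returned, so that hypothesis and conclusion have the same shape and the
  rule can be iterated over nested integrals.\<close>

lemma nn_integral_le_integral_AE:
  assumes "integrable M G" and AE: "AE x in M. 0 \<le> G x \<and> F x \<le> ennreal (G x)"
  shows "0 \<le> (\<integral>x. G x \<partial>M) \<and> (\<integral>\<^sup>+x. F x \<partial>M) \<le> ennreal (\<integral>x. G x \<partial>M)"
proof
  show "0 \<le> (\<integral>x. G x \<partial>M)" using AE by (intro integral_nonneg_AE) (auto elim: eventually_mono)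
  have "(\<integral>\<^sup>+x. F x \<partial>M) \<le> (\<integral>\<^sup>+x. ennreal (G x) \<partial>M)"
    using AE by (intro nn_integral_mono_AE) (auto elim: eventually_mono)
  also have "\<dots> = ennreal (\<integral>x. G x \<partial>M)"
    using AE by (intro nn_integral_eq_integral assms) (auto elim: eventually_mono)
  finally show "(\<integral>\<^sup>+x. F x \<partial>M) \<le> ennreal (\<integral>x. G x \<partial>M)" .
qed

lemmas nn_integral_le_integral = nn_integral_le_integral_AE[OF _ AE_I2]

subsection \<open>Gradients, the simplex and client sampling\<close>

text \<open>Riesz representation in coordinates: the values of the derivative on the basis are the
  components of the gradient. Uniqueness of derivatives makes the description in \<open>grad\<close>
  proper.\<close>

lemma GDERIV_grad:
  fixes f :: "'a::euclidean_space \<Rightarrow> real"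
  assumes "f differentiable (at x)"
  shows "GDERIV f x :> grad f x"
proof -
  obtain f' where f': "(f has_derivative f') (at x)" using assms by (auto simp: differentiable_def)
  interpret bounded_linear f' by (rule has_derivative_bounded_linear[OF f'])
  have "f' = (\<lambda>h. h \<bullet> (\<Sum>b\<in>Basis. f' b *\<^sub>R b))"
  proof
    fix h
    have "f' h = f' (\<Sum>b\<in>Basis. (h \<bullet> b) *\<^sub>R b)" by (simp add: euclidean_representation)
    also have "\<dots> = h \<bullet> (\<Sum>b\<in>Basis. f' b *\<^sub>R b)"
      by (simp add: sum scaleR inner_sum_right mult.commute)
    finally show "f' h = h \<bullet> (\<Sum>b\<in>Basis. f' b *\<^sub>R b)" .
  qed
  then have 1: "GDERIV f x :> (\<Sum>b\<in>Basis. f' b *\<^sub>R b)" using f' by (simp add: gderiv_def)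
  have "D = E" if "GDERIV f x :> D" "GDERIV f x :> E" for D E
  proof -
    have "(\<lambda>h. h \<bullet> D) = (\<lambda>h. h \<bullet> E)"
      using that unfolding gderiv_def by (rule has_derivative_unique)
    then show ?thesis by (metis vector_eq_ldot)
  qed
  with 1 show ?thesis unfolding grad_def by (metis theI)
qed

lemma grad_eqI:
  fixes f :: "'a::euclidean_space \<Rightarrow> real"
  assumes "GDERIV f x :> D" shows "grad f x = D"
proof -
  have "f differentiable (at x)" using assms by (auto simp: gderiv_def differentiable_def)
  from GDERIV_grad[OF this] assms have "(\<lambda>h. h \<bullet> D) = (\<lambda>h. h \<bullet> grad f x)"
    unfolding gderiv_def by (metis has_derivative_unique)
  then show ?thesis by (metis vector_eq_ldot)
qed

lemma GDERIV_scaled_sum: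
  assumes "\<And>i. i \<in> I \<Longrightarrow> GDERIV (F i) x :> D i"
  shows "GDERIV (\<lambda>x. c * (\<Sum>i\<in>I. F i x)) x :> c *\<^sub>R (\<Sum>i\<in>I. D i)"
  using assms unfolding gderiv_def
  by (auto intro!: derivative_eq_intros ext simp: inner_sum_right)

lemma GDERIV_global_obj:
  fixes f :: "'n::finite \<Rightarrow> 'm \<Rightarrow> 'a::euclidean_space \<Rightarrow> real"
  assumes "\<And>i. f i k differentiable (at x)"
  shows "GDERIV (global_obj f k) x :> (1 / real CARD('n)) *\<^sub>R (\<Sum>i\<in>UNIV. grad (f i k) x)"
  using GDERIV_scaled_sum[of UNIV "\<lambda>i. f i k" x "\<lambda>i. grad (f i k) x" "1 / real CARD('n)"]
    GDERIV_grad[OF assms] by (simp add: global_obj_def[abs_def])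

text \<open>On the segment from \<open>x\<close> to \<open>x + d\<close>, the function
  \<open>?p\<close>, which is \<open>F\<close> minus its linear and quadratic majorant terms, has
  nonpositive derivative by Cauchy-Schwarz and the Lipschitz bound; comparing its values at 1 and 0
  gives the claim.\<close>

lemma descent_lemma:
  fixes F :: "'a::euclidean_space \<Rightarrow> real"
  assumes F: "\<And>x. GDERIV F x :> G x" and L: "\<And>x y. norm (G x - G y) \<le> L * norm (x - y)"
  shows "F (x + d) \<le> F x + G x \<bullet> d + L / 2 * (norm d)\<^sup>2"
proof -
  let ?p = "\<lambda>s. F (x + s *\<^sub>R d) - s * (G x \<bullet> d) - L / 2 * s\<^sup>2 * (norm d)\<^sup>2"
  have F': "((\<lambda>s. F (x + s *\<^sub>R d)) has_real_derivative (d \<bullet> G (x + s *\<^sub>R d))) (at s)" for s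
  proof -
    have "((\<lambda>s. x + s *\<^sub>R d) has_derivative (\<lambda>h. h *\<^sub>R d)) (at s)"
      by (auto intro!: derivative_eq_intros)
    from diff_chain_at[OF this F[unfolded gderiv_def]]
    have "((\<lambda>s. F (x + s *\<^sub>R d)) has_derivative (\<lambda>h. (h *\<^sub>R d) \<bullet> G (x + s *\<^sub>R d))) (at s)"
      by (simp add: o_def)
    then show ?thesis
      by (rule has_derivative_imp_has_field_derivative) simp
  qed
  have p': "(?p has_real_derivative (d \<bullet> G (x + s *\<^sub>R d) - G x \<bullet> d - L * s * (norm d)\<^sup>2)) (at s)" for s
    by (rule derivative_eq_intros F' refl | simp)+
  have "?p 1 \<le> ?p 0"
  proof (rule DERIV_nonpos_imp_nonincreasing[of 0 1 ?p])
    fix s :: real assume s: "0 \<le> s" "s \<le> 1"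
    have "(G (x + s *\<^sub>R d) - G x) \<bullet> d \<le> norm (G (x + s *\<^sub>R d) - G x) * norm d"
      by (rule norm_cauchy_schwarz)
    also have "\<dots> \<le> L * norm (s *\<^sub>R d) * norm d"
      using L[of "x + s *\<^sub>R d" x] by (intro mult_right_mono) auto
    also have "\<dots> = L * s * (norm d)\<^sup>2" using s by (simp add: power2_eq_square)
    finally have "d \<bullet> G (x + s *\<^sub>R d) - G x \<bullet> d - L * s * (norm d)\<^sup>2 \<le> 0"
      by (simp add: inner_diff_left inner_diff_right inner_commute)
    with p' show "\<exists>y. (?p has_real_derivative y) (at s) \<and> y \<le> 0" by blast
  qed simp
  then show ?thesis by simp
qed

section \<open>The probability simplex and convex combinations\<close>

lemma prob_simplex_nonempty: "(\<chi> k. 1 / real CARD('m)) \<in> (prob_simplex :: (real ^ 'm::finite) set)"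
  by (simp add: prob_simplex_def)

lemma convex_prob_simplex: "convex prob_simplex"
  by (auto simp: convex_def prob_simplex_def sum.distrib sum_distrib_left[symmetric])

lemma closed_prob_simplex: "closed (prob_simplex :: (real ^ 'm::finite) set)"
proof -
  have "prob_simplex = (\<Inter>k. {w :: real ^ 'm. 0 \<le> w $ k}) \<inter> {w. (\<Sum>k\<in>UNIV. w $ k) = 1}"
    by (auto simp: prob_simplex_def)
  moreover have "closed ((\<Inter>k. {w :: real ^ 'm. 0 \<le> w $ k}) \<inter> {w. (\<Sum>k\<in>UNIV. w $ k) = 1})"
    by (intro closed_Int closed_INT ballI closed_Collect_le closed_Collect_eq continuous_intros)
  ultimately show ?thesis by simp
qed

lemma prob_simplexD: "w \<in> prob_simplex \<Longrightarrow> 0 \<le> w $ k" "w \<in> prob_simplex \<Longrightarrow> (\<Sum>k\<in>UNIV. w $ k) = 1"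
  by (auto simp: prob_simplex_def)

lemma weight_update_in_simplex: "weight_update \<beta> G w \<in> prob_simplex"
  unfolding weight_update_def using prob_simplex_nonempty
  by (intro closest_point_in_set closed_prob_simplex) auto

text \<open>The projection is 1-Lipschitz and fixes \<open>u\<close>. It is applied both with the
  uniform weight and with the old weight \<open>w\<close> as \<open>u\<close>.\<close>

lemma weight_update_dist:
  assumes "u \<in> prob_simplex"
  shows "norm (weight_update \<beta> G w - u) \<le> norm (w - \<beta> *\<^sub>R (G *v w) - u)"
  using closest_point_lipschitz[OF convex_prob_simplex closed_prob_simplex, of "w - \<beta> *\<^sub>R (G *v w)" u]
    closest_point_self[OF assms] assms by (auto simp: weight_update_def dist_norm)

text \<open>Jensen's inequality for the squared norm: the weighted variance of the
  \<open>z k\<close> around their weighted mean \<open>?m\<close> is nonnegative.\<close>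

lemma norm_simplex_sum_sq_le:
  fixes z :: "'m::finite \<Rightarrow> 'a::real_inner"
  assumes w: "w \<in> prob_simplex"
  shows "(norm (\<Sum>k\<in>UNIV. w $ k *\<^sub>R z k))\<^sup>2 \<le> (\<Sum>k\<in>UNIV. w $ k * (norm (z k))\<^sup>2)"
proof -
  let ?m = "\<Sum>k\<in>UNIV. w $ k *\<^sub>R z k"
  have "0 \<le> (\<Sum>k\<in>UNIV. w $ k * (norm (z k - ?m))\<^sup>2)"
    using prob_simplexD[OF w] by (intro sum_nonneg) auto
  also have "\<dots> = (\<Sum>k\<in>UNIV. w $ k * (norm (z k))\<^sup>2 - 2 * ((w $ k *\<^sub>R z k) \<bullet> ?m) + w $ k * (norm ?m)\<^sup>2)"
    by (intro sum.cong refl) (simp add: power2_norm_eq_inner inner_diff_left inner_diff_right inner_commute algebra_simps)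
  also have "\<dots> = (\<Sum>k\<in>UNIV. w $ k * (norm (z k))\<^sup>2) - 2 * (?m \<bullet> ?m) + (norm ?m)\<^sup>2"
    by (simp only: sum.distrib sum_subtractf sum_distrib_left[symmetric] sum_distrib_right[symmetric]
        inner_sum_left[symmetric] prob_simplexD[OF w] mult_1_left)
  finally show ?thesis by (simp add: power2_norm_eq_inner)
qed

lemma norm_simplex_sum_le:
  fixes z :: "'m::finite \<Rightarrow> 'a::real_inner"
  assumes w: "w \<in> prob_simplex" and z: "\<And>k. norm (z k) \<le> b"
  shows "norm (\<Sum>k\<in>UNIV. w $ k *\<^sub>R z k) \<le> b"
proof -
  have "norm (\<Sum>k\<in>UNIV. w $ k *\<^sub>R z k) \<le> (\<Sum>k\<in>UNIV. w $ k * b)"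
    using z prob_simplexD[OF w] by (intro sum_norm_le) (auto intro!: mult_left_mono)
  then show ?thesis using prob_simplexD[OF w] by (simp add: sum_distrib_right[symmetric])
qed

section \<open>Moments of uniform sampling without replacement\<close>

text \<open>Removing \<open>i\<close> is a bijection onto the subsets of \<open>S - {i}\<close> of
  size \<open>b - 1\<close>. A general \<open>S\<close> is needed to count sets that contain one
  client and avoid another.\<close>

lemma card_subsets_containing:
  assumes "finite S" "i \<in> S" "1 \<le> b"
  shows "card {B. B \<subseteq> S \<and> card B = b \<and> i \<in> B} = (card S - 1) choose (b - 1)"
proof -
  have "{B. B \<subseteq> S \<and> card B = b \<and> i \<in> B} = insert i ` {B. B \<subseteq> S - {i} \<and> card B = b - 1}"
  proof (intro equalityI subsetI)
    fix B assume B: "B \<in> {B. B \<subseteq> S \<and> card B = b \<and> i \<in> B}"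
    then have "B = insert i (B - {i})" "B - {i} \<in> {B. B \<subseteq> S - {i} \<and> card B = b - 1}"
      using assms by (auto simp: card_Diff_singleton)
    then show "B \<in> insert i ` {B. B \<subseteq> S - {i} \<and> card B = b - 1}" by blast
  next
    fix B assume "B \<in> insert i ` {B. B \<subseteq> S - {i} \<and> card B = b - 1}"
    then obtain B' where B': "B = insert i B'" "B' \<subseteq> S - {i}" "card B' = b - 1" by auto
    then have "finite B'" "i \<notin> B'" using assms finite_subset by auto
    with B' assms show "B \<in> {B. B \<subseteq> S \<and> card B = b \<and> i \<in> B}" by auto
  qed
  moreover have "inj_on (insert i) {B. B \<subseteq> S - {i} \<and> card B = b - 1}"
    by (auto simp: inj_on_def insert_eq_iff)
  ultimately show ?thesis
    using assms by (simp add: card_image n_subsets)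
qed

text \<open>This is the probability that a uniform set of size \<open>b\<close> contains one given
  client and misses another. It follows from two absorption identities for binomial
  coefficients.\<close>

lemma choose_ratio:
  assumes "2 \<le> N" "1 \<le> b" "b \<le> N"
  shows "real ((N - 2) choose (b - 1)) / real (N choose b)
    = real b * (real N - real b) / (real N * (real N - 1))"
proof -
  \<comment> \<open>Successor forms of \<open>N\<close> and \<open>b\<close> replace truncated
    subtractions before passing to reals.\<close>
  define m c where "m = N - 2" and "c = b - 1"
  have N: "N = Suc (Suc m)" and b: "b = Suc c" using assms by (auto simp: m_def c_def)
  have 1: "real (Suc (Suc m)) * real (Suc m choose c) = real (Suc c) * real (Suc (Suc m) choose Suc c)"
    by (metis Suc_times_binomial of_nat_mult)
  have "(Suc m - c) * (Suc m choose c) = Suc m * (m choose c)"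
    using binomial_absorb_comp[of "Suc m" c] by simp
  then have "real (Suc m - c) * real (Suc m choose c) = real (Suc m) * real (m choose c)"
    by (metis of_nat_mult)
  moreover have "real (Suc m - c) = real N - real b" using assms unfolding N b by (simp add: of_nat_diff)
  ultimately have 2: "(real N - real b) * real (Suc m choose c) = real (Suc m) * real (m choose c)" by simp
  have pos: "real (N choose b) > 0" using assms by (simp add: zero_less_binomial)
  have "real (m choose c) * (real N * (real N - 1)) = (real N - real b) * (real (Suc (Suc m)) * real (Suc m choose c))"
    using 2 unfolding N by (simp add: mult_ac)
  also have "\<dots> = (real N - real b) * (real b * real (N choose b))" unfolding 1 by (simp add: N b)
  finally have "real (m choose c) / real (N choose b) = real b * (real N - real b) / (real N * (real N - 1))"
    using pos assms by (simp add: frac_eq_eq mult_ac)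
  then show ?thesis unfolding m_def c_def .
qed

lemma prob_space_client_sampling: "prob_space (client_sampling b)"
  by (simp add: client_sampling_def measure_pmf.prob_space_axioms)

lemma ex_set_of_card: "b \<le> CARD('n::finite) \<Longrightarrow> {B :: 'n set. card B = b} \<noteq> {}"
  using obtain_subset_with_card_n[of b "UNIV :: 'n set"] by auto

lemma AE_client_sampling:
  assumes "b \<le> CARD('n::finite)"
  shows "AE B in (client_sampling b :: 'n set measure). card B = b"
  unfolding client_sampling_def
  by (simp add: AE_measure_pmf_iff set_pmf_of_set[OF ex_set_of_card[OF assms] finite])

lemma integral_client_sampling:
  fixes F :: "'n::finite set \<Rightarrow> 'a::euclidean_space"
  assumes "b \<le> CARD('n)"
  shows "integrable (client_sampling b) F"
    "(\<integral>B. F B \<partial>client_sampling b) = (1 / real (CARD('n) choose b)) *\<^sub>R (\<Sum>B | card B = b. F B)"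
proof -
  have c: "card {B :: 'n set. card B = b} = CARD('n) choose b"
    using n_subsets[of "UNIV :: 'n set" b] by simp
  show "integrable (client_sampling b) F"
    unfolding client_sampling_def by (rule integrable_measure_pmf_finite) simp
  show "(\<integral>B. F B \<partial>client_sampling b) = (1 / real (CARD('n) choose b)) *\<^sub>R (\<Sum>B | card B = b. F B)"
    unfolding client_sampling_def
    using ex_set_of_card[OF assms]
    by (subst integral_measure_pmf[of "{B. card B = b}"])
      (auto simp: c pmf_of_set scaleR_sum_right)
qed

text \<open>Double counting: every client lies in the same number of sets of size
  \<open>b\<close>.\<close>

lemma sum_sets_sum:
  fixes u :: "'n::finite \<Rightarrow> 'a::real_vector"
  assumes "1 \<le> b"
  shows "(\<Sum>B | card B = b. \<Sum>i\<in>B. u i) = real ((CARD('n) - 1) choose (b - 1)) *\<^sub>R (\<Sum>i\<in>UNIV. u i)"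
proof -
  have "(\<Sum>B | card B = b. \<Sum>i\<in>B. u i) = (\<Sum>B | card B = b. \<Sum>i | i \<in> UNIV \<and> i \<in> B. u i)"
    by simp
  also have "\<dots> = (\<Sum>i\<in>UNIV. \<Sum>B | B \<in> {B. card B = b} \<and> i \<in> B. u i)"
    by (rule sum.swap_restrict) auto
  also have "\<dots> = (\<Sum>i\<in>UNIV. real ((CARD('n) - 1) choose (b - 1)) *\<^sub>R u i)"
  proof (rule sum.cong[OF refl])
    fix i :: 'n
    have "card {B. card B = b \<and> i \<in> B} = (CARD('n) - 1) choose (b - 1)"
      using card_subsets_containing[of UNIV i b] assms by simp
    then show "(\<Sum>B | B \<in> {B. card B = b} \<and> i \<in> B. u i) = real ((CARD('n) - 1) choose (b - 1)) *\<^sub>R u i"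
      by (simp add: sum_constant_scaleR)
  qed
  finally show ?thesis by (simp add: scaleR_sum_right)
qed

text \<open>The square expands into pairs \<open>(i, j)\<close>, each weighted by the number of sets
  containing both. With \<open>?c1\<close> sets through a given client and \<open>?d\<close> sets
  containing \<open>i\<close> but not \<open>j\<close>, the matrix of these numbers is
  \<open>?c1 - ?d\<close> times the all-ones matrix plus \<open>?d\<close> times the identity; the
  former part contributes the squared norm of the total sum, which is 0.\<close>

lemma sum_sets_norm_sq:
  fixes u :: "'n::finite \<Rightarrow> 'a::real_inner"
  assumes b: "1 \<le> b" and u: "(\<Sum>i\<in>UNIV. u i) = 0"
  shows "(\<Sum>B | card B = b. (norm (\<Sum>i\<in>B. u i))\<^sup>2)
    = real ((CARD('n) - 2) choose (b - 1)) * (\<Sum>i\<in>UNIV. (norm (u i))\<^sup>2)"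
proof -
  let ?c1 = "real ((CARD('n) - 1) choose (b - 1))" and ?d = "real ((CARD('n) - 2) choose (b - 1))"
  have c: "(\<Sum>B | card B = b \<and> i \<in> B \<and> j \<in> B. 1) = ?c1 - (if i = j then 0 else ?d)" for i j :: 'n
  proof -
    have c1: "card {B. card B = b \<and> i \<in> B} = (CARD('n) - 1) choose (b - 1)"
      using card_subsets_containing[of UNIV i b] b by simp
    show ?thesis
    proof (cases "i = j")
      case True then show ?thesis using c1 by simp
    next
      case False
      have "{B. card B = b \<and> i \<in> B} = {B. card B = b \<and> i \<in> B \<and> j \<in> B} \<union> {B. B \<subseteq> UNIV - {j} \<and> card B = b \<and> i \<in> B}"
        by auto
      moreover have "card ({B. card B = b \<and> i \<in> B \<and> j \<in> B} \<union> {B. B \<subseteq> UNIV - {j} \<and> card B = b \<and> i \<in> B})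
         = card {B. card B = b \<and> i \<in> B \<and> j \<in> B} + card {B. B \<subseteq> UNIV - {j} \<and> card B = b \<and> i \<in> B}"
        by (rule card_Un_disjoint) auto
      moreover have "card {B. B \<subseteq> UNIV - {j} \<and> card B = b \<and> i \<in> B} = (CARD('n) - 2) choose (b - 1)"
        using card_subsets_containing[of "UNIV - {j}" i b] b False by (simp add: card_Diff_singleton numeral_2_eq_2)
      ultimately show ?thesis using c1 False by simp
    qed
  qed
  have "(\<Sum>B | card B = b. (norm (\<Sum>i\<in>B. u i))\<^sup>2)
    = (\<Sum>B | card B = b. \<Sum>i\<in>UNIV. \<Sum>j\<in>UNIV. (if i \<in> B \<and> j \<in> B then u i \<bullet> u j else 0))"
  proof (rule sum.cong[OF refl])
    fix B :: "'n set"
    have "(\<Sum>i\<in>B. u i) = (\<Sum>i\<in>UNIV. if i \<in> B then u i else 0)"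
      by (simp add: sum.inter_restrict[symmetric])
    then show "(norm (\<Sum>i\<in>B. u i))\<^sup>2 = (\<Sum>i\<in>UNIV. \<Sum>j\<in>UNIV. (if i \<in> B \<and> j \<in> B then u i \<bullet> u j else 0))"
      by (simp only: power2_norm_eq_inner inner_sum_left inner_sum_right) (auto intro!: sum.cong simp: inner_commute)
  qed
  also have "\<dots> = (\<Sum>i\<in>UNIV. \<Sum>j\<in>UNIV. \<Sum>B | card B = b. (if i \<in> B \<and> j \<in> B then u i \<bullet> u j else 0))"
    by (subst sum.swap, intro sum.cong refl, rule sum.swap)
  also have "\<dots> = (\<Sum>i\<in>UNIV. \<Sum>j\<in>UNIV. (u i \<bullet> u j) * (\<Sum>B | card B = b \<and> i \<in> B \<and> j \<in> B. 1))"
  proof (intro sum.cong refl)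
    fix i j
    have "(\<Sum>B | card B = b. (if i \<in> B \<and> j \<in> B then u i \<bullet> u j else 0))
      = (\<Sum>B | B \<in> {B. card B = b} \<and> (i \<in> B \<and> j \<in> B). u i \<bullet> u j)"
      by (rule sum.inter_filter[symmetric]) simp
    then show "(\<Sum>B | card B = b. (if i \<in> B \<and> j \<in> B then u i \<bullet> u j else 0))
      = (u i \<bullet> u j) * (\<Sum>B | card B = b \<and> i \<in> B \<and> j \<in> B. 1)" by simp
  qed
  also have "\<dots> = (\<Sum>i\<in>UNIV. \<Sum>j\<in>UNIV. (?c1 - ?d) * (u i \<bullet> u j) + (if i = j then ?d * (u i \<bullet> u j) else 0))"
    unfolding c by (intro sum.cong refl) (auto simp: algebra_simps)
  also have "\<dots> = (?c1 - ?d) * ((\<Sum>i\<in>UNIV. u i) \<bullet> (\<Sum>i\<in>UNIV. u i)) + ?d * (\<Sum>i\<in>UNIV. (norm (u i))\<^sup>2)"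
    by (simp add: sum.distrib inner_sum_left inner_sum_right sum_distrib_left power2_norm_eq_inner)
      (rule sum.swap)
  finally show ?thesis using u by simp
qed

text \<open>The factor is the finite population correction: it comes from
  \<open>choose_ratio\<close> divided by the square of \<open>b\<close>, and it vanishes when all
  clients are selected.\<close>

lemma client_sampling_centered:
  fixes v :: "'n::finite \<Rightarrow> 'a::euclidean_space"
  defines "m \<equiv> (1 / real CARD('n)) *\<^sub>R (\<Sum>i\<in>UNIV. v i)"
  assumes N: "2 \<le> CARD('n)" and b: "1 \<le> b" "b \<le> CARD('n)"
  shows "centered (client_sampling b) (\<lambda>B. (1 / real b) *\<^sub>R (\<Sum>i\<in>B. v i) - m)
    ((real CARD('n) - real b) / (real b * (real CARD('n) - 1))
       * ((1 / real CARD('n)) * (\<Sum>i\<in>UNIV. (norm (v i - m))\<^sup>2)))"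
proof -
  let ?u = "\<lambda>i. v i - m" and ?S = "\<lambda>B. (1 / real b) *\<^sub>R (\<Sum>i\<in>B. v i - m)"
  interpret prob_space "client_sampling b :: 'n set measure" by (rule prob_space_client_sampling)
  have u: "(\<Sum>i\<in>UNIV. ?u i) = 0"
    by (simp add: sum_subtractf m_def sum_constant_scaleR)
  have "centered (client_sampling b) ?S
    ((real CARD('n) - real b) / (real b * (real CARD('n) - 1))
       * ((1 / real CARD('n)) * (\<Sum>i\<in>UNIV. (norm (v i - m))\<^sup>2)))"
  proof (rule centeredI)
    show "(\<integral>B. ?S B \<partial>client_sampling b) = 0"
      using sum_sets_sum[OF b(1), of ?u] u
      by (simp add: integral_client_sampling[OF b(2)] scaleR_sum_right[symmetric])
    have "(\<integral>B. (norm (?S B))\<^sup>2 \<partial>client_sampling b)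
      = (1 / real b)\<^sup>2 * (real ((CARD('n) - 2) choose (b - 1)) / real (CARD('n) choose b)) * (\<Sum>i\<in>UNIV. (norm (?u i))\<^sup>2)"
      using sum_sets_norm_sq[OF b(1) u]
      by (simp add: integral_client_sampling[OF b(2)] power_mult_distrib sum_distrib_left[symmetric] power_divide sum_divide_distrib[symmetric])
    also have "\<dots> = (real CARD('n) - real b) / (real b * (real CARD('n) - 1))
       * ((1 / real CARD('n)) * (\<Sum>i\<in>UNIV. (norm (v i - m))\<^sup>2))"
      unfolding choose_ratio[OF N b] using b by (simp add: power2_eq_square)
    finally show "(\<integral>B. (norm (?S B))\<^sup>2 \<partial>client_sampling b) \<le> (real CARD('n) - real b) / (real b * (real CARD('n) - 1))
       * ((1 / real CARD('n)) * (\<Sum>i\<in>UNIV. (norm (v i - m))\<^sup>2))" by simp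
  qed (simp_all add: integral_client_sampling[OF b(2)])
  \<comment> \<open>Averaging \<open>v i - m\<close> agrees with subtracting \<open>m\<close> from
    the average only for sets of size exactly \<open>b\<close>, that is, almost everywhere.\<close>
  moreover have "(\<integral>\<^sup>+B. ennreal ((norm (a + ?S B))\<^sup>2) \<partial>client_sampling b)
    = (\<integral>\<^sup>+B. ennreal ((norm (a + ((1 / real b) *\<^sub>R (\<Sum>i\<in>B. v i) - m)))\<^sup>2) \<partial>client_sampling b)" for a
  proof (rule nn_integral_cong_AE)
    note AE_client_sampling[OF b(2)]
    then show "AE B in client_sampling b. ennreal ((norm (a + ?S B))\<^sup>2)
      = ennreal ((norm (a + ((1 / real b) *\<^sub>R (\<Sum>i\<in>B. v i) - m)))\<^sup>2)"
      using b by (auto simp: sum_subtractf scaleR_diff_right sum_constant_scaleR)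
  qed
  ultimately show ?thesis unfolding centered_def by (auto simp: client_sampling_def)
qed

subsection \<open>The Gram sketch\<close>

lemma (in prob_space) centered_shift:
  fixes S :: "'a \<Rightarrow> 'b::euclidean_space"
  assumes c: "centered M S v"
  shows "integrable M (\<lambda>x. (norm (a + S x))\<^sup>2)" "(\<integral>x. (norm (a + S x))\<^sup>2 \<partial>M) \<le> (norm a)\<^sup>2 + v"
  unfolding norm_add_sq using centeredD[OF c] by (simp_all add: prob_space)

lemma measurable_mem_client_sampling:
  assumes "A \<in> measurable N (client_sampling b)"
  shows "Measurable.pred N (\<lambda>\<omega>. i \<in> A \<omega>)"
proof -
  have "A \<in> measurable N (count_space UNIV)" using assms by (simp add: client_sampling_def)
  from measurable_sets[OF this, of "{B. i \<in> B}"] show ?thesis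
    by (simp add: pred_def vimage_def Int_def conj_commute)
qed

text \<open>\<open>T\<close> and \<open>x0\<close> stay outside: single-round estimates hold at
  every point, and estimates for the run quantify over both. \<open>C\<^sub>1\<close> is a parameter
  with a defining equation, which keeps its expansion folded.\<close>

locale fedcmoo_setting =
  fixes f :: "'n::finite \<Rightarrow> 'm::finite \<Rightarrow> 'a::euclidean_space \<Rightarrow> real"
    and g :: "'n \<Rightarrow> 'm \<Rightarrow> 'a \<Rightarrow> 's \<Rightarrow> 'a" and D :: "'n \<Rightarrow> 's measure"
    and Q :: "'a \<Rightarrow> 'c \<Rightarrow> 'a" and C :: "'c measure"
    and L \<sigma> \<sigma>\<^sub>g B q \<eta>\<^sub>l \<eta>\<^sub>g \<beta> C\<^sub>1 :: real
    and n n' \<tau> :: nat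
  assumes clients: "CARD('n) \<ge> 2"
    and sizes: "1 \<le> n" "n \<le> CARD('n)" "1 \<le> n'" "n' \<le> CARD('n)"
    and rounds: "1 \<le> \<tau>"
    and constants: "0 \<le> L" "0 \<le> \<sigma>" "0 \<le> \<sigma>\<^sub>g" "0 < B" "0 < q"
    and rates: "0 < \<eta>\<^sub>l" "0 < \<eta>\<^sub>g" "0 < \<beta>"
    and differentiable: "\<And>i k x. f i k differentiable (at x)"
    and bounded_below: "\<And>k. bdd_below (range (global_obj f k))"
    and prob_D: "\<And>i. prob_space (D i)"
    and prob_C: "prob_space C"
    and meas_g: "\<And>i k. (\<lambda>(x, s). g i k x s) \<in> borel_measurable (borel \<Otimes>\<^sub>M D i)"
    and meas_Q: "(\<lambda>(x, c). Q x c) \<in> borel_measurable (borel \<Otimes>\<^sub>M C)"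
    and A1: "\<And>i k x x'. norm (grad (f i k) x - grad (f i k) x') \<le> L * norm (x - x')"
    and A2_mean: "\<And>i k x. integrable (D i) (g i k x)"
                 "\<And>i k x. (\<integral>s. g i k x s \<partial>D i) = grad (f i k) x"
    and A2_var: "\<And>i k x. integrable (D i) (\<lambda>s. (norm (g i k x s - grad (f i k) x))\<^sup>2)"
                "\<And>i k x. (\<integral>s. (norm (g i k x s - grad (f i k) x))\<^sup>2 \<partial>D i) \<le> \<sigma>\<^sup>2"
    and A3: "\<And>k x. (1 / real CARD('n)) *
               (\<Sum>i\<in>UNIV. (norm (grad (f i k) x - grad (global_obj f k) x))\<^sup>2) \<le> \<sigma>\<^sub>g\<^sup>2"
    and A4: "\<And>i k x. norm (grad (f i k) x) \<le> B"
    and A5_mean: "\<And>x. integrable C (Q x)"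
                 "\<And>x. (\<integral>c. Q x c \<partial>C) = x"
    and A5_var: "\<And>x. integrable C (\<lambda>c. (norm (Q x c - x))\<^sup>2)"
                "\<And>x. (\<integral>c. (norm (Q x c - x))\<^sup>2 \<partial>C) \<le> q * (norm x)\<^sup>2"
    and C\<^sub>1_eq: "C\<^sub>1 = C1_const CARD('n) n' q \<sigma> \<sigma>\<^sub>g B"
begin

abbreviation "df \<equiv> \<lambda>i k. grad (f i k)"
abbreviation "dF \<equiv> \<lambda>k. grad (global_obj f k)"

lemma GDERIV_F: "GDERIV (global_obj f k) x :> dF k x"
  unfolding grad_eqI[OF GDERIV_global_obj[OF differentiable]]
  by (rule GDERIV_global_obj[OF differentiable])

lemma grad_F: "dF k x = (1 / real CARD('n)) *\<^sub>R (\<Sum>i\<in>UNIV. df i k x)"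
  by (rule grad_eqI[OF GDERIV_global_obj[OF differentiable]])

lemma norm_average_le:
  fixes v :: "'n \<Rightarrow> 'b::real_normed_vector"
  assumes "\<And>i. norm (v i) \<le> b"
  shows "norm ((1 / real CARD('n)) *\<^sub>R (\<Sum>i\<in>UNIV. v i)) \<le> b"
  using sum_norm_le[of UNIV v "\<lambda>_. b"] assms by (simp add: field_simps)

lemma norm_grad_F: "norm (dF k x) \<le> B"
  unfolding grad_F by (rule norm_average_le) (rule A4)

lemma grad_F_lipschitz: "norm (dF k x - dF k y) \<le> L * norm (x - y)"
  unfolding grad_F scaleR_diff_right[symmetric] sum_subtractf[symmetric]
  by (rule norm_average_le) (rule A1)

lemma lipschitz_imp_borel_measurable:
  fixes G :: "'a \<Rightarrow> 'a"
  assumes "\<And>x y. norm (G x - G y) \<le> L * norm (x - y)"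
  shows "G \<in> borel_measurable borel"
proof -
  have "L-lipschitz_on UNIV G" by (rule lipschitz_onI) (use assms constants in \<open>auto simp: dist_norm\<close>)
  then show ?thesis by (intro borel_measurable_continuous_onI lipschitz_on_continuous_on)
qed

lemma measurable_grad_f [measurable]: "df i k \<in> borel_measurable borel"
  by (rule lipschitz_imp_borel_measurable) (rule A1)

lemma measurable_grad_F [measurable]: "dF k \<in> borel_measurable borel"
  by (rule lipschitz_imp_borel_measurable) (rule grad_F_lipschitz)

lemma measurable_F [measurable]: "global_obj f k \<in> borel_measurable borel"
proof (rule borel_measurable_continuous_onI)
  have "isCont (global_obj f k) x" for x
    using GDERIV_F[unfolded gderiv_def] by (rule has_derivative_continuous)
  then show "continuous_on UNIV (global_obj f k)"
    by (simp add: continuous_at_imp_continuous_on)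
qed

lemma measurable_g [measurable (raw)]:
  assumes "x \<in> borel_measurable N" "s \<in> measurable N (D i)"
  shows "(\<lambda>\<omega>. g i k (x \<omega>) (s \<omega>)) \<in> borel_measurable N"
  using measurable_compose[OF measurable_Pair[OF assms] meas_g] by simp

lemma measurable_Q [measurable (raw)]:
  assumes "x \<in> borel_measurable N" "s \<in> measurable N C"
  shows "(\<lambda>\<omega>. Q (x \<omega>) (s \<omega>)) \<in> borel_measurable N"
  using measurable_compose[OF measurable_Pair[OF assms] meas_Q] by simp

lemma centered_g: "centered (D i) (\<lambda>s. g i k x s - df i k x) (\<sigma>\<^sup>2)"
proof -
  interpret prob_space "D i" by (rule prob_D)
  show ?thesis by (rule centeredI) (use A2_mean A2_var in \<open>simp_all add: prob_space\<close>)
qed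

lemma centered_Q: "centered C (\<lambda>c. Q x c - x) (q * (norm x)\<^sup>2)"
proof -
  interpret prob_space C by (rule prob_C)
  show ?thesis by (rule centeredI) (use A5_mean A5_var in \<open>simp_all add: prob_space\<close>)
qed

lemma prob_PiM_D: "prob_space (PiM I D)"
  by (rule prob_space_PiM') (rule prob_D)

lemma prob_PiM_C: "prob_space (PiM I (\<lambda>_. C))"
  by (rule prob_space_PiM') (rule prob_C)

lemma prob_gram_space: "prob_space (gram_space D C n' :: ('n, 'm, 's, 'c) gram_seed measure)"
  unfolding gram_space_def
  by (intro prob_space_pair prob_space_client_sampling prob_PiM_D prob_PiM_C)

lemma measurable_gram_sketch:
  assumes [measurable]: "x \<in> borel_measurable N"
    and s: "s \<in> measurable N (gram_space D C n' :: ('n, 'm, 's, 'c) gram_seed measure)"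
  shows "(\<lambda>\<omega>. gram_sketch g Q n' (x \<omega>) (s \<omega>) $ k) \<in> borel_measurable N"
proof -
  have s'[measurable]: "s \<in> measurable N (client_sampling n' \<Otimes>\<^sub>M (PiM UNIV D \<Otimes>\<^sub>M PiM UNIV (\<lambda>_. C)))"
    using s by (simp add: gram_space_def)
  have 1: "(\<lambda>\<omega>. fst (s \<omega>)) \<in> measurable N (client_sampling n')" by measurable
  have [measurable]: "(\<lambda>\<omega>. fst (snd (s \<omega>)) i) \<in> measurable N (D i)" for i
    by (rule measurable_compose[OF _ measurable_component_singleton[of i UNIV D]]) auto
  have [measurable]: "(\<lambda>\<omega>. snd (snd (s \<omega>)) j) \<in> measurable N C" for j
    by (rule measurable_compose[OF _ measurable_component_singleton[of j UNIV "\<lambda>_. C"]]) auto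
  have [measurable]: "Measurable.pred N (\<lambda>\<omega>. i \<in> fst (s \<omega>))" for i
    by (rule measurable_mem_client_sampling[OF 1])
  \<comment> \<open>A sum over a random index set becomes a sum over all clients with a measurable
    condition.\<close>
  have "gram_sketch g Q n' (x \<omega>) (s \<omega>) $ k = (1 / real n') *\<^sub>R (\<Sum>i\<in>UNIV.
      if i \<in> fst (s \<omega>) then Q (g i k (x \<omega>) (fst (snd (s \<omega>)) i)) (snd (snd (s \<omega>)) (i, k)) else 0)" for \<omega>
    by (simp add: gram_sketch_def split_beta sum.inter_restrict[symmetric])
  then show ?thesis by simp
qed

text \<open>With clients and gradient draws fixed, column \<open>k\<close> reads only the
  compression seeds \<open>(i, k)\<close> with \<open>i\<close> in \<open>A\<close>. These are
  independent, and \<open>i \<mapsto> (i, k)\<close> is injective, so the variances of the scaled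
  errors add.\<close>

lemma centered_gram_sketch_compression:
  "centered (PiM UNIV (\<lambda>_. C)) (\<lambda>c. gram_sketch g Q n' x (A, \<xi>, c) $ k - (1 / real n') *\<^sub>R (\<Sum>i\<in>A. g i k x (\<xi> i)))
     (\<Sum>i\<in>A. (1 / real n')\<^sup>2 * (q * (norm (g i k x (\<xi> i)))\<^sup>2))"
proof -
  let ?v = "\<lambda>i. g i k x (\<xi> i)"
  have inj: "inj_on (\<lambda>i. (i, k)) A" by (auto simp: inj_on_def)
  have "centered (PiM UNIV (\<lambda>_. C))
     (\<lambda>c. \<Sum>j\<in>(\<lambda>i. (i, k)) ` A. (1 / real n') *\<^sub>R (Q (?v (fst j)) (c j) - ?v (fst j)))
     (\<Sum>j\<in>(\<lambda>i. (i, k)) ` A. (1 / real n')\<^sup>2 * (q * (norm (?v (fst j)))\<^sup>2))"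
    by (rule centered_sum_PiM_subset[where Z="\<lambda>j y. (1 / real n') *\<^sub>R (Q (?v (fst j)) y - ?v (fst j))"])
      (auto intro!: prob_C centered_scale centered_Q)
  then show ?thesis
    by (simp add: sum.reindex[OF inj] gram_sketch_def sum_subtractf scaleR_diff_right scaleR_sum_right)
qed

text \<open>The scale \<open>c\<close> is free because two instances occur:
  \<open>1 / real n'\<close> over the selected clients, and 1 over a singleton, which yields the
  second moment of one stochastic gradient on the product space.\<close>

lemma centered_sum_g:
  "centered (PiM UNIV D) (\<lambda>\<xi>. \<Sum>i\<in>A. c *\<^sub>R (g i k x (\<xi> i) - df i k x)) (real (card A) * (c\<^sup>2 * \<sigma>\<^sup>2))"
proof -
  have "centered (PiM UNIV D) (\<lambda>\<xi>. \<Sum>i\<in>A. c *\<^sub>R (g i k x (\<xi> i) - df i k x)) (\<Sum>i\<in>A. c\<^sup>2 * \<sigma>\<^sup>2)"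
    by (rule centered_sum_PiM_subset[where Z="\<lambda>i y. c *\<^sub>R (g i k x y - df i k x)"])
      (auto intro!: prob_D centered_scale centered_g)
  then show ?thesis by simp
qed

text \<open>The error is peeled off in three levels whose variances add: compression, gradient
  draws, client sampling. The compression variance is proportional to the squared stochastic
  gradient, of mean at most \<open>B\<^sup>2 + \<sigma>\<^sup>2\<close>; together with the gradient
  variance this gives \<open>?K\<close>, and sampling gives \<open>?vs\<close>. The last summand
  \<open>B\<^sup>2\<close> of \<open>C\<^sub>1\<close> bounds the squared mean, so
  \<open>C\<^sub>1\<close> itself bounds the second moment.\<close>

lemma centered_gram_sketch:
  "centered (gram_space D C n' :: ('n, 'm, 's, 'c) gram_seed measure)
     (\<lambda>s. gram_sketch g Q n' x s $ k - dF k x) (C\<^sub>1 - B\<^sup>2)"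
proof -
  let ?Y = "\<lambda>s :: ('n, 'm, 's, 'c) gram_seed. gram_sketch g Q n' x s $ k"
  let ?vs = "(real CARD('n) - real n') / (real n' * (real CARD('n) - 1)) * \<sigma>\<^sub>g\<^sup>2"
  let ?K = "(\<sigma>\<^sup>2 + q * (B\<^sup>2 + \<sigma>\<^sup>2)) / real n'"
  have [measurable]: "?Y \<in> borel_measurable (gram_space D C n')"
    using measurable_gram_sketch[of "\<lambda>_. x" _ "\<lambda>s. s" k] by simp
  then have Y[measurable]: "?Y \<in> borel_measurable (client_sampling n' \<Otimes>\<^sub>M (PiM UNIV D \<Otimes>\<^sub>M PiM UNIV (\<lambda>_. C)))"
    by (simp add: gram_space_def)
  interpret XI: prob_space "PiM UNIV D" by (rule prob_PiM_D)
  interpret CC: prob_space "PiM UNIV (\<lambda>_ :: 'n \<times> 'm. C)" by (rule prob_PiM_C)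
  interpret PP: prob_space "PiM UNIV D \<Otimes>\<^sub>M PiM UNIV (\<lambda>_ :: 'n \<times> 'm. C)"
    by (intro prob_space_pair prob_PiM_D prob_PiM_C)
  have K: "0 \<le> ?K" using constants by simp
  have vs: "centered (client_sampling n') (\<lambda>A. (1 / real n') *\<^sub>R (\<Sum>i\<in>A. df i k x) - dF k x) ?vs"
    using client_sampling_centered[OF clients sizes(3,4), of "\<lambda>i. df i k x"] A3[of k x] sizes clients
    unfolding grad_F[symmetric] by (elim centered_mono) (intro mult_left_mono, auto)
  have vs0: "0 \<le> ?vs" using vs unfolding centered_def by (rule conjunct1)
  have C1: "C\<^sub>1 - B\<^sup>2 = ?vs + ?K"
  proof -
    have "?K = (q + 1) / real n' * \<sigma>\<^sup>2 + q * B\<^sup>2 / real n'"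
      by (simp add: add_divide_distrib[symmetric] distrib_left distrib_right)
    then show ?thesis unfolding C\<^sub>1_eq C1_const_def by linarith
  qed
  have level_\<xi>: "(\<integral>\<^sup>+s. ennreal ((norm (a + (?Y (A, s) - dF k x)))\<^sup>2) \<partial>(PiM UNIV D \<Otimes>\<^sub>M PiM UNIV (\<lambda>_. C)))
      \<le> ennreal ((norm (a + ((1 / real n') *\<^sub>R (\<Sum>i\<in>A. df i k x) - dF k x)))\<^sup>2 + ?K)"
    if A: "card A = n'" for A a
  proof -
    \<comment> \<open>The bound left after the compression seeds are integrated out; it is still
      random through the gradient draws.\<close>
    let ?G = "\<lambda>\<xi>. (norm (a - dF k x + (1 / real n') *\<^sub>R (\<Sum>i\<in>A. g i k x (\<xi> i))))\<^sup>2
      + (\<Sum>i\<in>A. (1 / real n')\<^sup>2 * (q * (norm (g i k x (\<xi> i)))\<^sup>2))"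
    let ?b = "a + ((1 / real n') *\<^sub>R (\<Sum>i\<in>A. df i k x) - dF k x)"
    note c = centered_sum_g[where A = A and c = "1 / real n'" and k = k and x = x]
    have eq1: "a - dF k x + (1 / real n') *\<^sub>R (\<Sum>i\<in>A. g i k x (\<xi> i))
        = ?b + (\<Sum>i\<in>A. (1 / real n') *\<^sub>R (g i k x (\<xi> i) - df i k x))" for \<xi>
      by (simp add: scaleR_diff_right sum_subtractf scaleR_sum_right)
    have i1: "integrable (PiM UNIV D) (\<lambda>\<xi>. (norm (a - dF k x + (1 / real n') *\<^sub>R (\<Sum>i\<in>A. g i k x (\<xi> i))))\<^sup>2)"
      and e1: "(\<integral>\<xi>. (norm (a - dF k x + (1 / real n') *\<^sub>R (\<Sum>i\<in>A. g i k x (\<xi> i))))\<^sup>2 \<partial>PiM UNIV D)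
        \<le> (norm ?b)\<^sup>2 + real (card A) * ((1 / real n')\<^sup>2 * \<sigma>\<^sup>2)"
      unfolding eq1 using XI.centered_shift[OF c] by auto
    have i2: "integrable (PiM UNIV D) (\<lambda>\<xi>. (norm (g i k x (\<xi> i)))\<^sup>2)"
      and e2: "(\<integral>\<xi>. (norm (g i k x (\<xi> i)))\<^sup>2 \<partial>PiM UNIV D) \<le> B\<^sup>2 + \<sigma>\<^sup>2" for i
    proof -
      have "(norm (df i k x))\<^sup>2 \<le> B\<^sup>2" using A4[of i k x] by (simp add: power_mono)
      then show "integrable (PiM UNIV D) (\<lambda>\<xi>. (norm (g i k x (\<xi> i)))\<^sup>2)"
        "(\<integral>\<xi>. (norm (g i k x (\<xi> i)))\<^sup>2 \<partial>PiM UNIV D) \<le> B\<^sup>2 + \<sigma>\<^sup>2"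
        using XI.centered_shift[OF centered_sum_g[where A = "{i}" and c = 1 and k = k and x = x], of "df i k x"] by auto
    qed
    have "(\<integral>\<^sup>+s. ennreal ((norm (a + (?Y (A, s) - dF k x)))\<^sup>2) \<partial>(PiM UNIV D \<Otimes>\<^sub>M PiM UNIV (\<lambda>_. C)))
      = (\<integral>\<^sup>+\<xi>. \<integral>\<^sup>+c. ennreal ((norm (a + (?Y (A, \<xi>, c) - dF k x)))\<^sup>2) \<partial>PiM UNIV (\<lambda>_. C) \<partial>PiM UNIV D)"
    proof (rule CC.nn_integral_fst[symmetric])
      have "A \<in> space (client_sampling n')" by (simp add: client_sampling_def)
      from measurable_compose_Pair1[OF this Y]
      have [measurable]: "(\<lambda>s. ?Y (A, s)) \<in> borel_measurable (PiM UNIV D \<Otimes>\<^sub>M PiM UNIV (\<lambda>_. C))" .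
      show "(\<lambda>s. ennreal ((norm (a + (?Y (A, s) - dF k x)))\<^sup>2)) \<in> borel_measurable (PiM UNIV D \<Otimes>\<^sub>M PiM UNIV (\<lambda>_. C))"
        by measurable
    qed
    also have "\<dots> \<le> ennreal (\<integral>\<xi>. ?G \<xi> \<partial>PiM UNIV D)"
    proof (rule conjunct2[OF nn_integral_le_integral])
      show "integrable (PiM UNIV D) ?G" using i1 i2 by auto
      fix \<xi>
      have "(\<integral>\<^sup>+c. ennreal ((norm (a + (?Y (A, \<xi>, c) - dF k x)))\<^sup>2) \<partial>PiM UNIV (\<lambda>_. C))
        = (\<integral>\<^sup>+c. ennreal ((norm ((a - dF k x + (1 / real n') *\<^sub>R (\<Sum>i\<in>A. g i k x (\<xi> i)))
            + (?Y (A, \<xi>, c) - (1 / real n') *\<^sub>R (\<Sum>i\<in>A. g i k x (\<xi> i)))))\<^sup>2) \<partial>PiM UNIV (\<lambda>_. C))"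
        by (simp add: algebra_simps)
      also have "\<dots> \<le> ennreal (?G \<xi>)"
        by (rule centered_nn_integral[OF centered_gram_sketch_compression])
      finally show "0 \<le> ?G \<xi> \<and> (\<integral>\<^sup>+c. ennreal ((norm (a + (?Y (A, \<xi>, c) - dF k x)))\<^sup>2) \<partial>PiM UNIV (\<lambda>_. C)) \<le> ennreal (?G \<xi>)"
        using constants by (auto intro!: add_nonneg_nonneg sum_nonneg)
    qed
    also have "(\<integral>\<xi>. ?G \<xi> \<partial>PiM UNIV D) \<le> (norm ?b)\<^sup>2 + real (card A) * ((1 / real n')\<^sup>2 * \<sigma>\<^sup>2)
        + (\<Sum>i\<in>A. (1 / real n')\<^sup>2 * (q * (B\<^sup>2 + \<sigma>\<^sup>2)))"
    proof -
      have "(\<integral>\<xi>. ?G \<xi> \<partial>PiM UNIV D)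
        = (\<integral>\<xi>. (norm (a - dF k x + (1 / real n') *\<^sub>R (\<Sum>i\<in>A. g i k x (\<xi> i))))\<^sup>2 \<partial>PiM UNIV D)
          + (\<Sum>i\<in>A. (1 / real n')\<^sup>2 * (q * (\<integral>\<xi>. (norm (g i k x (\<xi> i)))\<^sup>2 \<partial>PiM UNIV D)))"
        using i1 i2 by simp
      also have "\<dots> \<le> (norm ?b)\<^sup>2 + real (card A) * ((1 / real n')\<^sup>2 * \<sigma>\<^sup>2)
        + (\<Sum>i\<in>A. (1 / real n')\<^sup>2 * (q * (B\<^sup>2 + \<sigma>\<^sup>2)))"
        using constants by (intro add_mono e1 sum_mono mult_left_mono e2) auto
      finally show ?thesis .
    qed
    also have "(norm ?b)\<^sup>2 + real (card A) * ((1 / real n')\<^sup>2 * \<sigma>\<^sup>2)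
        + (\<Sum>i\<in>A. (1 / real n')\<^sup>2 * (q * (B\<^sup>2 + \<sigma>\<^sup>2))) = (norm ?b)\<^sup>2 + ?K"
    proof -
      have "real n' * ((1 / real n')\<^sup>2 * r) = r / real n'" for r
        using sizes by (simp add: power2_eq_square)
      then show ?thesis unfolding sum_constant A by (simp only: add_divide_distrib add.assoc)
    qed
    finally show ?thesis by (simp add: ennreal_leI)
  qed
  have "(\<integral>\<^sup>+s. ennreal ((norm (a + (?Y s - dF k x)))\<^sup>2) \<partial>gram_space D C n') \<le> ennreal ((norm a)\<^sup>2 + (?vs + ?K))" for a
  proof -
    have "(\<integral>\<^sup>+s. ennreal ((norm (a + (?Y s - dF k x)))\<^sup>2) \<partial>gram_space D C n')
      = (\<integral>\<^sup>+A. \<integral>\<^sup>+s. ennreal ((norm (a + (?Y (A, s) - dF k x)))\<^sup>2) \<partial>(PiM UNIV D \<Otimes>\<^sub>M PiM UNIV (\<lambda>_. C)) \<partial>client_sampling n')"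
      unfolding gram_space_def by (rule PP.nn_integral_fst[symmetric]) measurable
    also have "\<dots> \<le> (\<integral>\<^sup>+A. ennreal ((norm (a + ((1 / real n') *\<^sub>R (\<Sum>i\<in>A. df i k x) - dF k x)))\<^sup>2 + ?K) \<partial>client_sampling n')"
    proof (rule nn_integral_mono_AE)
      note AE_client_sampling[OF sizes(4)]
      then show "AE A in client_sampling n'.
          (\<integral>\<^sup>+s. ennreal ((norm (a + (?Y (A, s) - dF k x)))\<^sup>2) \<partial>(PiM UNIV D \<Otimes>\<^sub>M PiM UNIV (\<lambda>_. C)))
          \<le> ennreal ((norm (a + ((1 / real n') *\<^sub>R (\<Sum>i\<in>A. df i k x) - dF k x)))\<^sup>2 + ?K)"
        by eventually_elim (rule level_\<xi>)
    qed
    also have "\<dots> = (\<integral>\<^sup>+A. ennreal ((norm (a + ((1 / real n') *\<^sub>R (\<Sum>i\<in>A. df i k x) - dF k x)))\<^sup>2) \<partial>client_sampling n')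
        + ennreal ?K"
      using K by (simp add: client_sampling_def nn_integral_add measure_pmf.emeasure_space_1)
    also have "\<dots> \<le> ennreal ((norm a)\<^sup>2 + ?vs) + ennreal ?K"
      by (intro add_right_mono centered_nn_integral[OF vs])
    also have "\<dots> = ennreal ((norm a)\<^sup>2 + (?vs + ?K))"
      using K vs0 by (simp only: ennreal_plus[symmetric] add_nonneg_nonneg zero_le_power2 add.assoc)
    finally show ?thesis .
  qed
  then show ?thesis unfolding centered_def C1 using K vs0 by (auto intro!: borel_measurable_diff)
qed

lemma gram_sketch_moments:
  defines "GS \<equiv> gram_space D C n' :: ('n, 'm, 's, 'c) gram_seed measure"
  shows "integrable GS (\<lambda>s. gram_sketch g Q n' x s $ k)"
    "(\<integral>s. gram_sketch g Q n' x s $ k \<partial>GS) = dF k x"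
    "integrable GS (\<lambda>s. (norm (gram_sketch g Q n' x s $ k))\<^sup>2)"
    "(\<integral>s. (norm (gram_sketch g Q n' x s $ k))\<^sup>2 \<partial>GS) \<le> C\<^sub>1"
proof -
  interpret prob_space GS unfolding GS_def by (rule prob_gram_space)
  note c = centered_gram_sketch[of x k, folded GS_def]
  have "integrable GS (\<lambda>s. (gram_sketch g Q n' x s $ k - dF k x) + dF k x)"
    by (intro Bochner_Integration.integrable_add centeredD(3)[OF c]) simp
  then show i: "integrable GS (\<lambda>s. gram_sketch g Q n' x s $ k)" by simp
  show "(\<integral>s. gram_sketch g Q n' x s $ k \<partial>GS) = dF k x"
    using centeredD(4)[OF c] i by (simp add: prob_space)
  have "(norm (dF k x))\<^sup>2 \<le> B\<^sup>2" using norm_grad_F[of k x] by (simp add: power_mono)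
  then show "integrable GS (\<lambda>s. (norm (gram_sketch g Q n' x s $ k))\<^sup>2)"
    "(\<integral>s. (norm (gram_sketch g Q n' x s $ k))\<^sup>2 \<partial>GS) \<le> C\<^sub>1"
    using centered_shift[OF c, of "dF k x"] by auto
qed

end

subsection \<open>Local training\<close>

lemma measurable_weight [measurable (raw)]:
  fixes w :: "'b \<Rightarrow> real ^ 'k::finite"
  assumes "w \<in> borel_measurable N"
  shows "(\<lambda>\<omega>. w \<omega> $ k) \<in> borel_measurable N"
  using assms by (rule borel_measurable_continuous_on[OF continuous_on_component[OF continuous_on_id]])

context fedcmoo_setting
begin

abbreviation "dir w i y s \<equiv> \<Sum>k\<in>UNIV. w $ k *\<^sub>R g i k y s"
abbreviation "mdir w i y \<equiv> \<Sum>k\<in>UNIV. w $ k *\<^sub>R df i k y"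
abbreviation "local_space T \<equiv> PiM {..<T::nat} (\<lambda>_. PiM UNIV D)"

text \<open>The martingale part of local training: errors of the stochastic directions, each
  evaluated at the iterate actually reached. With \<open>A\<close> a singleton it controls the drift
  of one client, with \<open>A\<close> the selected set the aggregated update.\<close>

definition noise :: "'a \<Rightarrow> real ^ 'm \<Rightarrow> 'n set \<Rightarrow> nat \<Rightarrow> (nat \<Rightarrow> 'n \<Rightarrow> 's) \<Rightarrow> 'a" where
  "noise x w A t z = (\<Sum>r<t. \<Sum>i\<in>A.
     dir w i (local_iter g \<eta>\<^sub>l x w i z r) (z r i) - mdir w i (local_iter g \<eta>\<^sub>l x w i z r))"

lemma measurable_seed:
  assumes "z \<in> measurable N (local_space T)" "r < T"
  shows "(\<lambda>\<omega>. z \<omega> r i) \<in> measurable N (D i)"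
  using assms by (auto intro: measurable_compose[OF _ measurable_component_singleton[of i UNIV D]]
      measurable_compose[OF _ measurable_component_singleton[of r "{..<T}"]])

lemma measurable_local_iter:
  assumes [measurable]: "x \<in> borel_measurable N" "w \<in> borel_measurable N"
    and z: "z \<in> measurable N (local_space T)" and "r \<le> T"
  shows "(\<lambda>\<omega>. local_iter g \<eta>\<^sub>l (x \<omega>) (w \<omega>) i (z \<omega>) r) \<in> borel_measurable N"
  using \<open>r \<le> T\<close>
proof (induction r)
  case (Suc r)
  have [measurable]: "(\<lambda>\<omega>. z \<omega> r i) \<in> measurable N (D i)"
    using z Suc.prems by (intro measurable_seed) auto
  have [measurable]: "(\<lambda>\<omega>. local_iter g \<eta>\<^sub>l (x \<omega>) (w \<omega>) i (z \<omega>) r) \<in> borel_measurable N"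
    using Suc by simp
  show ?case by simp
qed simp

text \<open>Adaptedness of the local process: it makes the seed of step \<open>j\<close> fresh
  relative to the iterate at which it is used.\<close>

lemma local_iter_upd: "r \<le> j \<Longrightarrow> local_iter g \<eta>\<^sub>l x w i (z(j := y)) r = local_iter g \<eta>\<^sub>l x w i z r"
  by (induction r) auto

lemma noise_upd: "t \<le> j \<Longrightarrow> noise x w A t (z(j := y)) = noise x w A t z"
  by (auto simp: noise_def local_iter_upd intro!: sum.cong)

lemma measurable_noise:
  assumes "t \<le> T"
  shows "noise x w A t \<in> borel_measurable (local_space T)"
  unfolding noise_def
proof (intro borel_measurable_sum)
  fix r i assume r: "r \<in> {..<t}"
  have [measurable]: "(\<lambda>z. z r i) \<in> measurable (local_space T) (D i)"
    "(\<lambda>z. local_iter g \<eta>\<^sub>l x w i z r) \<in> borel_measurable (local_space T)"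
    using r assms measurable_local_iter[of "\<lambda>_. x" "local_space T" "\<lambda>_. w" "\<lambda>z. z" T r i]
      measurable_seed[of "\<lambda>z. z" "local_space T" T r i] by auto
  show "(\<lambda>z. dir w i (local_iter g \<eta>\<^sub>l x w i z r) (z r i) - mdir w i (local_iter g \<eta>\<^sub>l x w i z r))
    \<in> borel_measurable (local_space T)" by measurable
qed

section \<open>Local training with the weights held fixed\<close>

context
  fixes w :: "real ^ 'm"
  assumes w: "w \<in> prob_simplex"
begin

lemma norm_mdir: "norm (mdir w i y) \<le> B"
  by (rule norm_simplex_sum_le[OF w A4])

lemma mdir_lipschitz: "norm (mdir w i y - mdir w i y') \<le> L * norm (y - y')"
  unfolding sum_subtractf[symmetric] scaleR_diff_right[symmetric]
  by (rule norm_simplex_sum_le[OF w A1])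

text \<open>By Jensen's inequality a convex combination of errors inherits the bound
  \<open>\<sigma>\<^sup>2\<close>, whatever their joint law under the shared draw; hence no factor
  \<open>CARD('m)\<close> arises here.\<close>

lemma centered_dir: "centered (D i) (\<lambda>s. dir w i y s - mdir w i y) (\<sigma>\<^sup>2)"
proof -
  interpret prob_space "D i" by (rule prob_D)
  have eq: "dir w i y s - mdir w i y = (\<Sum>k\<in>UNIV. w $ k *\<^sub>R (g i k y s - df i k y))" for s
    by (simp add: scaleR_diff_right sum_subtractf)
  have sq: "integrable (D i) (\<lambda>s. \<Sum>k\<in>UNIV. w $ k * (norm (g i k y s - df i k y))\<^sup>2)"
    using A2_var by auto
  have m: "(\<lambda>s. \<Sum>k\<in>UNIV. w $ k *\<^sub>R (g i k y s - df i k y)) \<in> borel_measurable (D i)" by measurable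
  show ?thesis unfolding eq
  proof (rule centeredI)
    show "integrable (D i) (\<lambda>s. \<Sum>k\<in>UNIV. w $ k *\<^sub>R (g i k y s - df i k y))"
      using A2_mean by auto
    show "(\<integral>s. (\<Sum>k\<in>UNIV. w $ k *\<^sub>R (g i k y s - df i k y)) \<partial>D i) = 0"
      using A2_mean by (simp add: prob_space)
    show i: "integrable (D i) (\<lambda>s. (norm (\<Sum>k\<in>UNIV. w $ k *\<^sub>R (g i k y s - df i k y)))\<^sup>2)"
      by (rule Bochner_Integration.integrable_bound[OF sq])
        (use m norm_simplex_sum_sq_le[OF w] in \<open>auto intro!: AE_I2 order.trans[OF _ abs_ge_self]\<close>)
    have "(\<integral>s. (norm (\<Sum>k\<in>UNIV. w $ k *\<^sub>R (g i k y s - df i k y)))\<^sup>2 \<partial>D i)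
      \<le> (\<integral>s. (\<Sum>k\<in>UNIV. w $ k * (norm (g i k y s - df i k y))\<^sup>2) \<partial>D i)"
      by (intro integral_mono i sq norm_simplex_sum_sq_le[OF w])
    also have "\<dots> = (\<Sum>k\<in>UNIV. w $ k * (\<integral>s. (norm (g i k y s - df i k y))\<^sup>2 \<partial>D i))"
      using A2_var by simp
    also have "\<dots> \<le> (\<Sum>k\<in>UNIV. w $ k * \<sigma>\<^sup>2)"
      using prob_simplexD[OF w] A2_var by (intro sum_mono mult_left_mono) auto
    finally show "(\<integral>s. (norm (\<Sum>k\<in>UNIV. w $ k *\<^sub>R (g i k y s - df i k y)))\<^sup>2 \<partial>D i) \<le> \<sigma>\<^sup>2"
      using prob_simplexD[OF w] by (simp add: sum_distrib_right[symmetric])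
  qed
qed

text \<open>Martingale increments are orthogonal: given the earlier steps, the noise so far is a
  constant shift, and the fresh seeds are independent across clients, adding
  \<open>card A * \<sigma>\<^sup>2\<close> per step.\<close>

lemma centered_noise:
  assumes "t \<le> T"
  shows "centered (local_space T) (noise x w A t) (real t * (real (card A) * \<sigma>\<^sup>2))"
proof -
  let ?c = "real (card A) * \<sigma>\<^sup>2"
  have "(\<integral>\<^sup>+z. ennreal ((norm (a + noise x w A t z))\<^sup>2) \<partial>local_space T) \<le> ennreal ((norm a)\<^sup>2 + real t * ?c)" for a
  proof -
    have "(\<integral>\<^sup>+z. ennreal ((norm (a + noise x w A t z))\<^sup>2) + (\<Sum>j<t. 0) \<partial>local_space T)
      \<le> ennreal ((norm (a + noise x w A 0 (\<lambda>_. undefined)))\<^sup>2) + of_nat t * ennreal ?c"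
    proof (rule nn_integral_PiM_drift[where h = "\<lambda>_ _. 0"])
      fix j u
      let ?x = "\<lambda>i. local_iter g \<eta>\<^sub>l x w i u j"
      have "centered (PiM UNIV D) (\<lambda>y. \<Sum>i\<in>A. dir w i (?x i) (y i) - mdir w i (?x i)) (\<Sum>i\<in>A. \<sigma>\<^sup>2)"
        by (rule centered_sum_PiM_subset[where Z = "\<lambda>i y. dir w i (?x i) y - mdir w i (?x i)"])
          (auto intro: prob_D centered_dir)
      from centered_nn_integral[OF this, of "a + noise x w A j u"]
      have "(\<integral>\<^sup>+y. ennreal ((norm (a + noise x w A j u + (\<Sum>i\<in>A. dir w i (?x i) (y i) - mdir w i (?x i))))\<^sup>2) \<partial>PiM UNIV D)
        \<le> ennreal ((norm (a + noise x w A j u))\<^sup>2 + ?c)" by simp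
      moreover have "noise x w A (Suc j) (u(j := y)) = noise x w A j u + (\<Sum>i\<in>A. dir w i (?x i) (y i) - mdir w i (?x i))" for y
      proof -
        have "noise x w A (Suc j) (u(j := y)) = noise x w A j (u(j := y))
            + (\<Sum>i\<in>A. dir w i (?x i) (y i) - mdir w i (?x i))"
          by (simp add: noise_def local_iter_upd)
        then show ?thesis by (simp add: noise_upd)
      qed
      ultimately show "(\<integral>\<^sup>+y. ennreal ((norm (a + noise x w A (Suc j) (u(j := y))))\<^sup>2) \<partial>PiM UNIV D) + 0
        \<le> ennreal ((norm (a + noise x w A j u))\<^sup>2) + ennreal ?c"
        by (simp add: add.assoc)
    qed (use assms measurable_noise in \<open>auto intro!: prob_PiM_D simp: noise_upd[unfolded fun_upd_def]\<close>)
    then show ?thesis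
      by (simp add: noise_def ennreal_of_nat_eq_real_of_nat ennreal_mult[symmetric])
  qed
  then show ?thesis unfolding centered_def using measurable_noise[OF assms] by simp
qed

lemma local_iter_eq:
  "local_iter g \<eta>\<^sub>l x w i z r = x - \<eta>\<^sub>l *\<^sub>R ((\<Sum>j<r. mdir w i (local_iter g \<eta>\<^sub>l x w i z j)) + noise x w {i} r z)"
  by (induction r) (simp_all add: noise_def algebra_simps)

lemma local_iter_drift:
  "norm (local_iter g \<eta>\<^sub>l x w i z r - x) \<le> \<eta>\<^sub>l * (real r * B + norm (noise x w {i} r z))"
proof -
  have "norm (local_iter g \<eta>\<^sub>l x w i z r - x)
    = \<eta>\<^sub>l * norm ((\<Sum>j<r. mdir w i (local_iter g \<eta>\<^sub>l x w i z j)) + noise x w {i} r z)"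
    unfolding local_iter_eq[of x i z r] using rates by simp
  also have "\<dots> \<le> \<eta>\<^sub>l * (norm (\<Sum>j<r. mdir w i (local_iter g \<eta>\<^sub>l x w i z j)) + norm (noise x w {i} r z))"
    using rates by (intro mult_left_mono norm_triangle_ineq) auto
  also have "\<dots> \<le> \<eta>\<^sub>l * (real r * B + norm (noise x w {i} r z))"
    using rates sum_norm_le[of "{..<r}" "\<lambda>j. mdir w i (local_iter g \<eta>\<^sub>l x w i z j)" "\<lambda>_. B"] norm_mdir
    by (intro mult_left_mono add_right_mono) auto
  finally show ?thesis .
qed

lemma sum_local_delta:
  "(\<Sum>i\<in>A. local_delta g \<eta>\<^sub>l \<tau> x w i z)
    = (1 / real \<tau>) *\<^sub>R ((\<Sum>i\<in>A. \<Sum>r<\<tau>. mdir w i (local_iter g \<eta>\<^sub>l x w i z r)) + noise x w A \<tau> z)"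
proof -
  have "local_delta g \<eta>\<^sub>l \<tau> x w i z
    = (1 / real \<tau>) *\<^sub>R ((\<Sum>r<\<tau>. mdir w i (local_iter g \<eta>\<^sub>l x w i z r)) + noise x w {i} \<tau> z)" for i
    unfolding local_delta_def local_iter_eq[of x i z \<tau>] using rates by simp
  moreover have "noise x w A \<tau> z = (\<Sum>i\<in>A. noise x w {i} \<tau> z)"
    unfolding noise_def by (subst sum.swap) simp
  ultimately show ?thesis by (simp add: sum.distrib scaleR_sum_right[symmetric])
qed

end

end

subsection \<open>The server step\<close>

abbreviation uniform_weight :: "real ^ 'm::finite" where
  "uniform_weight \<equiv> \<chi> k. 1 / real CARD('m)"

text \<open>The shape copies the pathwise bound of a server step (drift term, linear noise, squared
  noise, constant), so that its expectation is computed by a single rewrite without unfolding the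
  large coefficients.\<close>

lemma (in prob_space) expectation_affine:
  fixes S :: "'a \<Rightarrow> 'b::euclidean_space" and X R :: "'a \<Rightarrow> real"
  assumes "integrable M X" "integrable M S" "integrable M R"
  shows "integrable M (\<lambda>z. a + b * (c * X z) - c * (p \<bullet> S z) + d * (e + h * R z) + k)"
    "(\<integral>z. a + b * (c * X z) - c * (p \<bullet> S z) + d * (e + h * R z) + k \<partial>M)
      = a + b * (c * (\<integral>z. X z \<partial>M)) - c * (p \<bullet> (\<integral>z. S z \<partial>M)) + d * (e + h * (\<integral>z. R z \<partial>M)) + k"
  using assms by (simp_all add: prob_space)

context fedcmoo_setting
begin

abbreviation "\<eta> \<equiv> \<eta>\<^sub>g * \<eta>\<^sub>l * real \<tau>"
abbreviation "jac w x \<equiv> \<Sum>k\<in>UNIV. w $ k *\<^sub>R dF k x"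
abbreviation "avg_grad x \<equiv> jac uniform_weight x"

lemma eta_pos: "0 < \<eta>"
  using rates rounds by simp

lemma opt_gap_nonneg: "0 \<le> opt_gap f x"
  unfolding opt_gap_def
  by (intro mult_nonneg_nonneg sum_nonneg) (auto intro!: cINF_lower bounded_below)

lemma measurable_opt_gap [measurable]: "opt_gap f \<in> borel_measurable borel"
  unfolding opt_gap_def[abs_def] by measurable

lemma GDERIV_opt_gap: "GDERIV (opt_gap f) x :> avg_grad x"
proof -
  have "GDERIV (\<lambda>x. global_obj f k x - (INF x. global_obj f k x)) x :> dF k x" for k
    using GDERIV_diff[OF GDERIV_F GDERIV_const] by simp
  from GDERIV_scaled_sum[of UNIV, OF this, of "1 / real CARD('m)"]
  show ?thesis by (simp add: opt_gap_def[abs_def] scaleR_sum_right)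
qed

lemma norm_avg_grad: "norm (avg_grad x) \<le> B"
  by (rule norm_simplex_sum_le[OF prob_simplex_nonempty norm_grad_F])

lemma avg_grad_lipschitz: "norm (avg_grad x - avg_grad y) \<le> L * norm (x - y)"
  unfolding sum_subtractf[symmetric] scaleR_diff_right[symmetric]
  by (rule norm_simplex_sum_le[OF prob_simplex_nonempty grad_F_lipschitz])

lemma opt_gap_descent: "opt_gap f (x + d) \<le> opt_gap f x + avg_grad x \<bullet> d + L / 2 * (norm d)\<^sup>2"
  by (rule descent_lemma[OF GDERIV_opt_gap avg_grad_lipschitz])

lemma average_mdir: "(1 / real CARD('n)) *\<^sub>R (\<Sum>i\<in>UNIV. mdir w i x) = jac w x"
  unfolding grad_F by (subst sum.swap) (simp add: scaleR_sum_right mult.commute)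

text \<open>Here \<open>w\<close> is the weight after its update and a free argument, so that
  clients and local seeds can be averaged while it is frozen.\<close>

definition server_step :: "'a \<Rightarrow> real ^ 'm \<Rightarrow> 'n set \<Rightarrow> (nat \<Rightarrow> 'n \<Rightarrow> 's) \<Rightarrow> 'a" where
  "server_step x w A z = x - \<eta> *\<^sub>R ((1 / real n) *\<^sub>R (\<Sum>i\<in>A. local_delta g \<eta>\<^sub>l \<tau> x w i z))"

text \<open>The first summand is the gradient bound \<open>B\<close> times \<open>L\<close> times
  the expected client drift, in which the noise norm has mean at most
  \<open>sqrt (real \<tau>) * \<sigma>\<close>. The second is the smoothness term after division by
  \<open>\<eta>\<close>, with the variance of the noise averaged over \<open>n\<close> clients and
  \<open>\<tau>\<close> steps.\<close>

definition step_err :: real where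
  "step_err = B * (L * (\<eta>\<^sub>l * (real \<tau> * B + sqrt (real \<tau>) * \<sigma>))) + L * \<eta> * (B\<^sup>2 + \<sigma>\<^sup>2 / (real n * real \<tau>))"

text \<open>The averaged update is \<open>s + e\<close>: mean directions along the iterates plus
  scaled noise. Moving the mean directions back to \<open>x\<close> costs \<open>R\<close> by
  Lipschitz continuity. The noise terms stay explicit, since the linear one vanishes and the others
  are bounded only in expectation.\<close>

lemma server_step_pointwise:
  fixes z :: "nat \<Rightarrow> 'n \<Rightarrow> 's"
  assumes w: "w \<in> prob_simplex" and A: "card A = n"
  shows "opt_gap f (server_step x w A z) / \<eta> \<le> opt_gap f x / \<eta>
     - avg_grad x \<bullet> ((1 / real n) *\<^sub>R (\<Sum>i\<in>A. mdir w i x))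
     + B * ((1 / (real n * real \<tau>)) * (\<Sum>i\<in>A. \<Sum>r<\<tau>. L * (\<eta>\<^sub>l * (real \<tau> * B + norm (noise x w {i} r z)))))
     - (1 / (real n * real \<tau>)) * (avg_grad x \<bullet> noise x w A \<tau> z)
     + L * \<eta> * (B\<^sup>2 + (1 / (real n * real \<tau>))\<^sup>2 * (norm (noise x w A \<tau> z))\<^sup>2)"
proof -
  let ?it = "\<lambda>i r. local_iter g \<eta>\<^sub>l x w i z r" and ?c = "1 / (real n * real \<tau>)" and ?p = "avg_grad x"
  let ?h = "(1 / real n) *\<^sub>R (\<Sum>i\<in>A. mdir w i x)"
  define s where "s = ?c *\<^sub>R (\<Sum>i\<in>A. \<Sum>r<\<tau>. mdir w i (?it i r))"
  define e where "e = ?c *\<^sub>R noise x w A \<tau> z"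
  define R where "R = ?c * (\<Sum>i\<in>A. \<Sum>r<\<tau>. L * (\<eta>\<^sub>l * (real \<tau> * B + norm (noise x w {i} r z))))"
  have c0: "0 \<le> ?c" by simp
  have cn: "?c * (real n * (real \<tau> * b)) = b" for b using sizes rounds by simp
  have x': "server_step x w A z = x + (- \<eta>) *\<^sub>R (s + e)"
    unfolding server_step_def sum_local_delta[OF w] s_def e_def
    by (simp add: scaleR_add_right)
  have "norm (\<Sum>i\<in>A. \<Sum>r<\<tau>. mdir w i (?it i r)) \<le> (\<Sum>i\<in>A. \<Sum>r<\<tau>. B)"
    by (intro sum_norm_le norm_mdir[OF w])
  then have "?c * norm (\<Sum>i\<in>A. \<Sum>r<\<tau>. mdir w i (?it i r)) \<le> ?c * (real n * (real \<tau> * B))"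
    using c0 by (intro mult_left_mono) (simp_all add: A)
  then have s: "norm s \<le> B" unfolding cn s_def by simp
  have "s - ?h = ?c *\<^sub>R (\<Sum>i\<in>A. \<Sum>r<\<tau>. mdir w i (?it i r) - mdir w i x)"
  proof -
    have "?h = ?c *\<^sub>R (\<Sum>i\<in>A. \<Sum>r<\<tau>. mdir w i x)"
      using rounds by (simp add: sum_constant_scaleR scaleR_sum_right[symmetric])
    then show ?thesis unfolding s_def by (simp only: sum_subtractf scaleR_diff_right)
  qed
  then have "norm (s - ?h) = ?c * norm (\<Sum>i\<in>A. \<Sum>r<\<tau>. mdir w i (?it i r) - mdir w i x)" by simp
  also have "\<dots> \<le> R"
    unfolding R_def
  proof (intro mult_left_mono c0 sum_norm_le)
    fix i r assume "r \<in> {..<\<tau>}"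
    have "norm (mdir w i (?it i r) - mdir w i x) \<le> L * norm (?it i r - x)" by (rule mdir_lipschitz[OF w])
    also have "\<dots> \<le> L * (\<eta>\<^sub>l * (real r * B + norm (noise x w {i} r z)))"
      using constants by (intro mult_left_mono local_iter_drift[OF w])
    also have "\<dots> \<le> L * (\<eta>\<^sub>l * (real \<tau> * B + norm (noise x w {i} r z)))"
      using constants rates \<open>r \<in> {..<\<tau>}\<close> by (intro mult_left_mono add_right_mono mult_right_mono) auto
    finally show "norm (mdir w i (?it i r) - mdir w i x) \<le> L * (\<eta>\<^sub>l * (real \<tau> * B + norm (noise x w {i} r z)))" .
  qed
  finally have sh: "norm (s - ?h) \<le> R" .
  have "?p \<bullet> ?h - ?p \<bullet> s \<le> norm ?p * norm (?h - s)"
    using norm_cauchy_schwarz[of ?p "?h - s"] by (simp add: inner_diff_right)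
  also have "\<dots> \<le> B * R"
    using sh norm_avg_grad[of x] constants by (intro mult_mono) (auto simp: norm_minus_commute)
  finally have ps: "- (?p \<bullet> s) \<le> - (?p \<bullet> ?h) + B * R" by simp
  \<comment> \<open>The cross term of \<open>s\<close> and \<open>e\<close> need not have mean zero,
    as \<open>s\<close> depends on earlier noise. It is removed pathwise, at the cost of a factor 2
    that cancels the one half in \<open>L / 2\<close>.\<close>
  have "0 \<le> (norm (s - e))\<^sup>2" by simp
  then have "(norm (s + e))\<^sup>2 \<le> 2 * (norm s)\<^sup>2 + 2 * (norm e)\<^sup>2"
    by (simp add: power2_norm_eq_inner algebra_simps inner_commute)
  also have "\<dots> \<le> 2 * B\<^sup>2 + 2 * (norm e)\<^sup>2"
    using s by (simp add: power_mono)
  finally have se: "(norm (s + e))\<^sup>2 \<le> 2 * (B\<^sup>2 + (norm e)\<^sup>2)" by simp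
  have "opt_gap f (server_step x w A z) / \<eta>
    \<le> (opt_gap f x + ?p \<bullet> ((- \<eta>) *\<^sub>R (s + e)) + L / 2 * (norm ((- \<eta>) *\<^sub>R (s + e)))\<^sup>2) / \<eta>"
    unfolding x' using eta_pos by (intro divide_right_mono opt_gap_descent) simp
  also have "\<dots> = opt_gap f x / \<eta> - ?p \<bullet> (s + e) + L / 2 * \<eta> * (norm (s + e))\<^sup>2"
  proof -
    \<comment> \<open>A single variable stands for the product \<open>\<eta>\<close> to keep
      simplification from splitting it.\<close>
    have "(a + ?p \<bullet> ((- \<theta>) *\<^sub>R (s + e)) + L / 2 * (norm ((- \<theta>) *\<^sub>R (s + e)))\<^sup>2) / \<theta>
      = a / \<theta> - ?p \<bullet> (s + e) + L / 2 * \<theta> * (norm (s + e))\<^sup>2" if "0 < \<theta>" for a \<theta> :: real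
      using that by (simp add: power_mult_distrib add_divide_distrib diff_divide_distrib power2_eq_square)
    from this[OF eta_pos] show ?thesis .
  qed
  also have "\<dots> \<le> opt_gap f x / \<eta> - ?p \<bullet> (s + e) + L / 2 * \<eta> * (2 * (B\<^sup>2 + (norm e)\<^sup>2))"
    using constants eta_pos by (intro add_left_mono mult_left_mono se) simp
  also have "\<dots> = opt_gap f x / \<eta> - ?p \<bullet> s - ?p \<bullet> e + L * \<eta> * (B\<^sup>2 + (norm e)\<^sup>2)"
    by (simp add: inner_add_right)
  also have "\<dots> \<le> opt_gap f x / \<eta> - ?p \<bullet> ?h + B * R - ?p \<bullet> e + L * \<eta> * (B\<^sup>2 + (norm e)\<^sup>2)"
    using ps by simp
  also have "(norm e)\<^sup>2 = ?c\<^sup>2 * (norm (noise x w A \<tau> z))\<^sup>2"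
    by (simp add: e_def power_mult_distrib power_divide)
  also have "?p \<bullet> e = ?c * (?p \<bullet> noise x w A \<tau> z)" unfolding e_def by (rule inner_scaleR_right)
  finally show ?thesis unfolding R_def .
qed

text \<open>Only the local seeds are averaged. \<open>\<kappa>\<close> stands for the weight part of
  the potential, constant at this level; carrying it inside the integral lets the bound be
  nested.\<close>

lemma server_step_local_expectation:
  fixes x :: 'a
  assumes w: "w \<in> prob_simplex" and A: "card A = n" and \<kappa>: "0 \<le> \<kappa>"
  defines "b \<equiv> opt_gap f x / \<eta> - avg_grad x \<bullet> ((1 / real n) *\<^sub>R (\<Sum>i\<in>A. mdir w i x)) + step_err + \<kappa>"
  shows "0 \<le> b \<and> (\<integral>\<^sup>+z. ennreal (opt_gap f (server_step x w A z) / \<eta> + \<kappa>) \<partial>local_space \<tau>) \<le> ennreal b"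
proof -
  interpret LS: prob_space "local_space \<tau>" by (intro prob_space_PiM' prob_PiM_D)
  let ?c = "1 / (real n * real \<tau>)" and ?p = "avg_grad x"
  let ?h = "(1 / real n) *\<^sub>R (\<Sum>i\<in>A. mdir w i x)"
  let ?S = "noise x w A \<tau>" and ?s = "\<lambda>i r. noise x w {i} r"
  let ?G = "\<lambda>z. opt_gap f x / \<eta> - ?p \<bullet> ?h
     + B * (?c * (\<Sum>i\<in>A. \<Sum>r<\<tau>. L * (\<eta>\<^sub>l * (real \<tau> * B + norm (?s i r z)))))
     - ?c * (?p \<bullet> ?S z) + L * \<eta> * (B\<^sup>2 + ?c\<^sup>2 * (norm (?S z))\<^sup>2) + \<kappa>"
  note S = LS.centeredD[OF centered_noise[OF w order_refl[of \<tau>], of x A]]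
  have s: "integrable (local_space \<tau>) (\<lambda>z. norm (?s i r z))"
    "(\<integral>z. norm (?s i r z) \<partial>local_space \<tau>) \<le> sqrt (real \<tau>) * \<sigma>" if "r < \<tau>" for i r
  proof -
    note c = centered_noise[OF w less_imp_le[OF that], of x "{i}"]
    show "integrable (local_space \<tau>) (\<lambda>z. norm (?s i r z))" by (rule LS.centered_norm_le(1)[OF c])
    have "(\<integral>z. norm (?s i r z) \<partial>local_space \<tau>) \<le> sqrt (real r * \<sigma>\<^sup>2)"
      using LS.centered_norm_le(2)[OF c] by simp
    also have "\<dots> = sqrt (real r) * \<sigma>" using constants by (simp add: real_sqrt_mult)
    also have "\<dots> \<le> sqrt (real \<tau>) * \<sigma>" using that constants by (intro mult_right_mono) auto
    finally show "(\<integral>z. norm (?s i r z) \<partial>local_space \<tau>) \<le> sqrt (real \<tau>) * \<sigma>" .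
  qed
  have i1: "integrable (local_space \<tau>) (\<lambda>z. \<Sum>i\<in>A. \<Sum>r<\<tau>. L * (\<eta>\<^sub>l * (real \<tau> * B + norm (?s i r z))))"
    by (intro Bochner_Integration.integrable_sum integrable_mult_right Bochner_Integration.integrable_add s) auto
  note G = LS.expectation_affine[OF i1 S(3,1)]
  have "0 \<le> (\<integral>z. ?G z \<partial>local_space \<tau>) \<and>
    (\<integral>\<^sup>+z. ennreal (opt_gap f (server_step x w A z) / \<eta> + \<kappa>) \<partial>local_space \<tau>) \<le> ennreal (\<integral>z. ?G z \<partial>local_space \<tau>)"
  proof (rule nn_integral_le_integral[OF G(1)])
    fix z
    have "0 \<le> opt_gap f (server_step x w A z) / \<eta>" using opt_gap_nonneg eta_pos by simp
    then show "0 \<le> ?G z \<and> ennreal (opt_gap f (server_step x w A z) / \<eta> + \<kappa>) \<le> ennreal (?G z)"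
      using server_step_pointwise[OF w A, of x z] \<kappa> by (auto intro!: ennreal_leI)
  qed
  moreover have "(\<integral>z. ?G z \<partial>local_space \<tau>) \<le> b"
  proof -
    have "(\<integral>z. ?G z \<partial>local_space \<tau>) = opt_gap f x / \<eta> - ?p \<bullet> ?h
     + B * (?c * (\<Sum>i\<in>A. \<Sum>r<\<tau>. L * (\<eta>\<^sub>l * (real \<tau> * B + (\<integral>z. norm (?s i r z) \<partial>local_space \<tau>)))))
     - ?c * (?p \<bullet> (\<integral>z. ?S z \<partial>local_space \<tau>))
     + L * \<eta> * (B\<^sup>2 + ?c\<^sup>2 * (\<integral>z. (norm (?S z))\<^sup>2 \<partial>local_space \<tau>)) + \<kappa>"
    proof -
      have "(\<integral>z. (\<Sum>i\<in>A. \<Sum>r<\<tau>. L * (\<eta>\<^sub>l * (real \<tau> * B + norm (?s i r z)))) \<partial>local_space \<tau>)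
        = (\<Sum>i\<in>A. \<Sum>r<\<tau>. L * (\<eta>\<^sub>l * (real \<tau> * B + (\<integral>z. norm (?s i r z) \<partial>local_space \<tau>))))"
      proof -
        have i2: "integrable (local_space \<tau>) (\<lambda>z. L * (\<eta>\<^sub>l * (real \<tau> * B + norm (?s i r z))))" if "r < \<tau>" for i r
          by (intro integrable_mult_right Bochner_Integration.integrable_add s that) auto
        have e: "(\<integral>z. L * (\<eta>\<^sub>l * (real \<tau> * B + norm (?s i r z))) \<partial>local_space \<tau>)
          = L * (\<eta>\<^sub>l * (real \<tau> * B + (\<integral>z. norm (?s i r z) \<partial>local_space \<tau>)))" if "r < \<tau>" for i r
          using s[OF that] by (simp add: LS.prob_space)
        have sw: "(\<integral>z. (\<Sum>i\<in>A. \<Sum>r<\<tau>. H i r z) \<partial>local_space \<tau>) = (\<Sum>i\<in>A. \<Sum>r<\<tau>. (\<integral>z. H i r z \<partial>local_space \<tau>))"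
          if "\<And>i r. r < \<tau> \<Longrightarrow> integrable (local_space \<tau>) (H i r)" for H :: "'n \<Rightarrow> nat \<Rightarrow> _ \<Rightarrow> real"
        proof -
          have "(\<integral>z. (\<Sum>i\<in>A. \<Sum>r<\<tau>. H i r z) \<partial>local_space \<tau>) = (\<Sum>i\<in>A. (\<integral>z. (\<Sum>r<\<tau>. H i r z) \<partial>local_space \<tau>))"
            by (rule Bochner_Integration.integral_sum) (auto intro!: that)
          also have "\<dots> = (\<Sum>i\<in>A. \<Sum>r<\<tau>. (\<integral>z. H i r z \<partial>local_space \<tau>))"
            by (intro sum.cong refl Bochner_Integration.integral_sum that) auto
          finally show ?thesis .
        qed
        show ?thesis by (subst sw[OF i2]) (auto simp: e intro!: sum.cong simp del: integral_mult_right_zero)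
      qed
      then show ?thesis unfolding G(2) by (rule arg_cong)
    qed
    also have "\<dots> \<le> opt_gap f x / \<eta> - ?p \<bullet> ?h
     + B * (?c * (\<Sum>i\<in>A. \<Sum>r<\<tau>. L * (\<eta>\<^sub>l * (real \<tau> * B + sqrt (real \<tau>) * \<sigma>))))
     - ?c * (?p \<bullet> 0) + L * \<eta> * (B\<^sup>2 + ?c\<^sup>2 * (real \<tau> * (real (card A) * \<sigma>\<^sup>2))) + \<kappa>"
    proof -
      have 1: "(\<Sum>i\<in>A. \<Sum>r<\<tau>. L * (\<eta>\<^sub>l * (real \<tau> * B + (\<integral>z. norm (?s i r z) \<partial>local_space \<tau>))))
        \<le> (\<Sum>i\<in>A. \<Sum>r<\<tau>. L * (\<eta>\<^sub>l * (real \<tau> * B + sqrt (real \<tau>) * \<sigma>)))"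
        using s constants rates by (intro sum_mono mult_left_mono add_left_mono) auto
      have 2: "?c\<^sup>2 * (\<integral>z. (norm (?S z))\<^sup>2 \<partial>local_space \<tau>) \<le> ?c\<^sup>2 * (real \<tau> * (real (card A) * \<sigma>\<^sup>2))"
        using S by (intro mult_left_mono) auto
      show ?thesis unfolding S(4)
        using constants eta_pos by (intro add_mono diff_mono mult_left_mono 1 2 order_refl) auto
    qed
    also have "\<dots> = b"
    proof -
      have "?c * (\<Sum>i\<in>A. \<Sum>r<\<tau>. y) = y" for y using sizes rounds by (simp add: A)
      moreover have "?c\<^sup>2 * (real \<tau> * (real (card A) * \<sigma>\<^sup>2)) = \<sigma>\<^sup>2 / (real n * real \<tau>)"
        using sizes rounds by (simp add: A power2_eq_square)
      ultimately show ?thesis unfolding b_def step_err_def by simp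
    qed
    finally show ?thesis .
  qed
  ultimately show ?thesis by (meson ennreal_leI order_trans)
qed

lemma measurable_server_step:
  assumes [measurable]: "x \<in> borel_measurable N" "w \<in> borel_measurable N"
    and A: "A \<in> measurable N (client_sampling n)" and z: "z \<in> measurable N (local_space \<tau>)"
  shows "(\<lambda>\<omega>. server_step (x \<omega>) (w \<omega>) (A \<omega>) (z \<omega>)) \<in> borel_measurable N"
proof -
  have [measurable]: "Measurable.pred N (\<lambda>\<omega>. i \<in> A \<omega>)" for i
    by (rule measurable_mem_client_sampling[OF A])
  have [measurable]: "(\<lambda>\<omega>. local_iter g \<eta>\<^sub>l (x \<omega>) (w \<omega>) i (z \<omega>) \<tau>) \<in> borel_measurable N" for i
    by (rule measurable_local_iter[OF _ _ z]) auto
  have "(\<Sum>i\<in>A \<omega>. local_delta g \<eta>\<^sub>l \<tau> (x \<omega>) (w \<omega>) i (z \<omega>))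
    = (\<Sum>i\<in>UNIV. if i \<in> A \<omega> then local_delta g \<eta>\<^sub>l \<tau> (x \<omega>) (w \<omega>) i (z \<omega>) else 0)" for \<omega>
    by (simp add: sum.inter_restrict[symmetric])
  then show ?thesis unfolding server_step_def local_delta_def by simp
qed

text \<open>After the local seeds are averaged, the client set enters only linearly, through the
  average of \<open>mdir w i x\<close>, whose mean is \<open>jac w x\<close>; hence no sampling
  variance appears.\<close>

lemma server_step_expectation:
  fixes x :: 'a
  assumes w: "w \<in> prob_simplex" and \<kappa>: "0 \<le> \<kappa>"
  defines "b \<equiv> opt_gap f x / \<eta> - avg_grad x \<bullet> jac w x + step_err + \<kappa>"
  shows "0 \<le> b \<and> (\<integral>\<^sup>+y. ennreal (opt_gap f (server_step x w (fst y) (snd y)) / \<eta> + \<kappa>)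
    \<partial>(client_sampling n \<Otimes>\<^sub>M local_space \<tau>)) \<le> ennreal b"
proof -
  interpret LS: prob_space "local_space \<tau>" by (intro prob_space_PiM' prob_PiM_D)
  interpret CS: prob_space "client_sampling n :: 'n set measure" by (rule prob_space_client_sampling)
  let ?h = "\<lambda>A. (1 / real n) *\<^sub>R (\<Sum>i\<in>A. mdir w i x)"
  let ?G = "\<lambda>A. opt_gap f x / \<eta> - avg_grad x \<bullet> ?h A + step_err + \<kappa>"
  note i = integral_client_sampling(1)[OF sizes(2)]
  have [measurable]: "(\<lambda>y. server_step x w (fst y) (snd y)) \<in> borel_measurable (client_sampling n \<Otimes>\<^sub>M local_space \<tau>)"
    by (rule measurable_server_step) auto
  have "(\<integral>A. ?h A - jac w x \<partial>client_sampling n) = 0"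
    using CS.centeredD(4)[OF client_sampling_centered[OF clients sizes(1,2), of "\<lambda>i. mdir w i x"]]
    unfolding average_mdir .
  then have h: "(\<integral>A. ?h A \<partial>client_sampling n) = jac w x"
    by (subst (asm) Bochner_Integration.integral_diff) (auto simp: i CS.prob_space)
  have G: "(\<integral>A. ?G A \<partial>client_sampling n) = b"
  proof -
    have "(\<integral>A. c - p \<bullet> H A + e + k \<partial>client_sampling n) = c - p \<bullet> (\<integral>A. H A \<partial>client_sampling n) + e + k"
      for c e k :: real and p :: 'a and H :: "'n set \<Rightarrow> 'a"
      using i[of H] by (simp add: CS.prob_space)
    then show ?thesis unfolding b_def h[symmetric] .
  qed
  have "(\<integral>\<^sup>+y. ennreal (opt_gap f (server_step x w (fst y) (snd y)) / \<eta> + \<kappa>) \<partial>(client_sampling n \<Otimes>\<^sub>M local_space \<tau>))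
    = (\<integral>\<^sup>+A. \<integral>\<^sup>+z. ennreal (opt_gap f (server_step x w A z) / \<eta> + \<kappa>) \<partial>local_space \<tau> \<partial>client_sampling n)"
    by (subst LS.nn_integral_fst[symmetric]) simp_all
  moreover have "0 \<le> (\<integral>A. ?G A \<partial>client_sampling n) \<and>
    (\<integral>\<^sup>+A. \<integral>\<^sup>+z. ennreal (opt_gap f (server_step x w A z) / \<eta> + \<kappa>) \<partial>local_space \<tau> \<partial>client_sampling n)
    \<le> ennreal (\<integral>A. ?G A \<partial>client_sampling n)"
    by (rule nn_integral_le_integral_AE[OF i])
      (use AE_client_sampling[OF sizes(2)] in eventually_elim, rule server_step_local_expectation[OF w _ \<kappa>])
  ultimately show ?thesis unfolding G by simp
qed

end

subsection \<open>The potential along the run\<close>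

lemma measurable_vec_lambda:
  fixes F :: "'k::finite \<Rightarrow> 'b \<Rightarrow> real"
  assumes [measurable]: "\<And>k. F k \<in> borel_measurable N"
  shows "(\<lambda>\<omega>. \<chi> k. F k \<omega>) \<in> borel_measurable N"
proof -
  have "(\<chi> k. F k \<omega>) = (\<Sum>k\<in>UNIV. F k \<omega> *\<^sub>R axis k 1)" for \<omega>
    by (simp add: vec_eq_iff axis_def if_distrib cong: if_cong)
  then show ?thesis by simp
qed

lemma gram_mat_vec: "(gram_mat Y Z *v w) $ k = Y $ k \<bullet> (\<Sum>l\<in>UNIV. w $ l *\<^sub>R Z $ l)"
  by (simp add: gram_mat_def matrix_vector_mult_def inner_sum_right mult.commute)

lemma measurable_weight_update:
  fixes Y Z :: "'b \<Rightarrow> 'a::euclidean_space ^ 'm::finite"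
  assumes [measurable]: "\<And>k. (\<lambda>\<omega>. Y \<omega> $ k) \<in> borel_measurable N"
    "\<And>k. (\<lambda>\<omega>. Z \<omega> $ k) \<in> borel_measurable N" "w \<in> borel_measurable N"
  shows "(\<lambda>\<omega>. weight_update \<beta> (gram_mat (Y \<omega>) (Z \<omega>)) (w \<omega>)) \<in> borel_measurable N"
proof -
  have "(\<lambda>\<omega>. \<chi> k. (gram_mat (Y \<omega>) (Z \<omega>) *v w \<omega>) $ k) \<in> borel_measurable N"
    unfolding gram_mat_vec by (rule measurable_vec_lambda) measurable
  then have [measurable]: "(\<lambda>\<omega>. gram_mat (Y \<omega>) (Z \<omega>) *v w \<omega>) \<in> borel_measurable N" by simp
  show ?thesis unfolding weight_update_def
    by (rule borel_measurable_continuous_on[OF continuous_on_closest_point])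
      (use convex_prob_simplex closed_prob_simplex prob_simplex_nonempty in auto)
qed

text \<open>Cauchy-Schwarz in each row, then Jensen in the weights. The bound is a product of a
  factor in \<open>Y\<close> and a factor in \<open>Z\<close>, so independent sketches can be
  averaged one after the other.\<close>

lemma gram_mat_vec_norm_sq:
  fixes Y Z :: "'a::euclidean_space ^ 'm::finite"
  assumes w: "w \<in> prob_simplex"
  shows "(norm (gram_mat Y Z *v w))\<^sup>2
    \<le> (\<Sum>k\<in>UNIV. (norm (Y $ k))\<^sup>2) * (\<Sum>l\<in>UNIV. w $ l * (norm (Z $ l))\<^sup>2)"
proof -
  let ?z = "\<Sum>l\<in>UNIV. w $ l *\<^sub>R Z $ l"
  have "(norm (gram_mat Y Z *v w))\<^sup>2 = (\<Sum>k\<in>UNIV. (Y $ k \<bullet> ?z)\<^sup>2)"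
    by (simp add: power2_norm_eq_inner inner_vec_def gram_mat_vec) (simp add: power2_eq_square)
  also have "\<dots> \<le> (\<Sum>k\<in>UNIV. (norm (Y $ k))\<^sup>2 * (norm ?z)\<^sup>2)"
  proof (rule sum_mono)
    fix k
    have "\<bar>Y $ k \<bullet> ?z\<bar>\<^sup>2 \<le> (norm (Y $ k) * norm ?z)\<^sup>2" by (intro power_mono Cauchy_Schwarz_ineq2) simp
    then show "(Y $ k \<bullet> ?z)\<^sup>2 \<le> (norm (Y $ k))\<^sup>2 * (norm ?z)\<^sup>2" by (simp add: power_mult_distrib)
  qed
  also have "\<dots> \<le> (\<Sum>k\<in>UNIV. (norm (Y $ k))\<^sup>2) * (\<Sum>l\<in>UNIV. w $ l * (norm (Z $ l))\<^sup>2)"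
    unfolding sum_distrib_right[symmetric]
    by (intro mult_left_mono norm_simplex_sum_sq_le[OF w] sum_nonneg) simp
  finally show ?thesis .
qed

text \<open>Projecting towards \<open>u\<close> contributes half of the last term. The other half
  comes from the move \<open>w' - w\<close>, of size at most \<open>\<beta> * norm (G *v w)\<close>,
  through Young's inequality against \<open>P\<close>. The vector \<open>P\<close> will represent
  the inner product of \<open>avg_grad x\<close> with \<open>jac\<close> as a functional of the
  weights.\<close>

lemma weight_update_progress:
  fixes G :: "real ^ 'm ^ 'm::finite"
  assumes w: "w \<in> prob_simplex" and u: "u \<in> prob_simplex" and \<beta>: "0 < \<beta>"
  defines "w' \<equiv> weight_update \<beta> G w"
  shows "(norm (w' - u))\<^sup>2 / (2 * \<beta>) - (w' - w) \<bullet> P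
    \<le> (norm (w - u))\<^sup>2 / (2 * \<beta>) - (w - u) \<bullet> (G *v w) + \<beta> / 2 * (norm P)\<^sup>2 + \<beta> * (norm (G *v w))\<^sup>2"
proof -
  let ?v = "G *v w"
  have "(norm (w' - u))\<^sup>2 \<le> (norm (w - \<beta> *\<^sub>R ?v - u))\<^sup>2"
    unfolding w'_def by (intro power_mono weight_update_dist[OF u]) simp
  also have "\<dots> = (norm (w - u))\<^sup>2 - 2 * \<beta> * ((w - u) \<bullet> ?v) + \<beta>\<^sup>2 * (norm ?v)\<^sup>2"
    using norm_add_sq[of "w - u" "- (\<beta> *\<^sub>R ?v)"] by (simp add: power_mult_distrib algebra_simps)
  finally have "(norm (w' - u))\<^sup>2 / (2 * \<beta>)
      \<le> ((norm (w - u))\<^sup>2 - 2 * \<beta> * ((w - u) \<bullet> ?v) + \<beta>\<^sup>2 * (norm ?v)\<^sup>2) / (2 * \<beta>)"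
    using \<beta> by (intro divide_right_mono) auto
  also have "\<dots> = (norm (w - u))\<^sup>2 / (2 * \<beta>) - (w - u) \<bullet> ?v + \<beta> / 2 * (norm ?v)\<^sup>2"
    using \<beta> by (simp add: add_divide_distrib diff_divide_distrib power2_eq_square)
  finally have 1: "(norm (w' - u))\<^sup>2 / (2 * \<beta>) \<le> (norm (w - u))\<^sup>2 / (2 * \<beta>) - (w - u) \<bullet> ?v + \<beta> / 2 * (norm ?v)\<^sup>2" .
  \<comment> \<open>The old weight lies in the simplex, so the projection fixes it and
    nonexpansiveness applies with \<open>u = w\<close>.\<close>
  have "norm (w' - w) \<le> \<beta> * norm ?v"
    using weight_update_dist[OF w, of \<beta> G w] \<beta> by (simp add: w'_def)
  have "- ((w' - w) \<bullet> P) \<le> norm (w' - w) * norm P"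
    using norm_cauchy_schwarz[of "w - w'" P] by (simp add: norm_minus_commute inner_diff_left)
  also have "\<dots> \<le> \<beta> * norm ?v * norm P"
    by (intro mult_right_mono) (use \<open>norm (w' - w) \<le> \<beta> * norm ?v\<close> in auto)
  also have "\<dots> \<le> \<beta> * (((norm ?v)\<^sup>2 + (norm P)\<^sup>2) / 2)"
    using sum_squares_bound[of "norm ?v" "norm P"] \<beta> unfolding mult.assoc by (intro mult_left_mono) auto
  finally have "- ((w' - w) \<bullet> P) \<le> \<beta> / 2 * (norm ?v)\<^sup>2 + \<beta> / 2 * (norm P)\<^sup>2"
    by (simp add: algebra_simps add_divide_distrib)
  with 1 show ?thesis by simp
qed

context fedcmoo_setting
begin

definition lyapunov :: "'a \<times> (real ^ 'm) \<Rightarrow> real" where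
  "lyapunov s = opt_gap f (fst s) / \<eta> + (norm (snd s - uniform_weight))\<^sup>2 / (2 * \<beta>)"

text \<open>Of the factor \<open>3 / 2\<close>, one half pays for \<open>(norm P)\<^sup>2\<close>
  and 1 for the squared Gram step, each at most \<open>CARD('m) * C\<^sub>1\<^sup>2\<close> (the
  latter in expectation).\<close>

definition round_err :: real where
  "round_err = step_err + 3 / 2 * (\<beta> * (real CARD('m) * C\<^sub>1\<^sup>2))"

text \<open>The entries of \<open>P\<close> are at most \<open>B\<^sup>2\<close>; this bound absorbs
  them into \<open>C\<^sub>1\<close>.\<close>

lemma C1_ge: "B\<^sup>2 \<le> C\<^sub>1"
proof -
  have "0 \<le> (real CARD('n) - real n') / (real n' * (real CARD('n) - 1)) * \<sigma>\<^sub>g\<^sup>2"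
    using clients sizes by (intro mult_nonneg_nonneg divide_nonneg_nonneg) auto
  moreover have "0 \<le> (q + 1) / real n' * \<sigma>\<^sup>2" "0 \<le> q * B\<^sup>2 / real n'" using constants by auto
  ultimately show ?thesis unfolding C\<^sub>1_eq C1_const_def by linarith
qed

lemma step_err_nonneg: "0 \<le> step_err"
  unfolding step_err_def using constants rates by (intro add_nonneg_nonneg mult_nonneg_nonneg) auto

lemma round_err_nonneg: "0 \<le> round_err"
  unfolding round_err_def using step_err_nonneg rates by simp

lemma lyapunov_nonneg: "0 \<le> lyapunov s"
  unfolding lyapunov_def using opt_gap_nonneg eta_pos rates by simp

lemma fedcmoo_round_eq:
  "fedcmoo_round g Q n n' \<tau> \<beta> \<eta>\<^sub>l \<eta>\<^sub>g s (x, w) =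
    (let w' = weight_update \<beta> (gram_mat (gram_sketch g Q n' x (fst s)) (gram_sketch g Q n' x (fst (snd s)))) w
     in (server_step x w' (fst (snd (snd s))) (snd (snd (snd s))), w'))"
  by (simp add: fedcmoo_round_def server_step_def Let_def split_beta)

abbreviation "round_measure \<equiv> round_space D C n n' \<tau> :: ('n, 'm, 's, 'c) round_seed measure"
abbreviation "gram_measure \<equiv> gram_space D C n' :: ('n, 'm, 's, 'c) gram_seed measure"

lemma prob_round_space: "prob_space round_measure"
  unfolding round_space_def
  by (intro prob_space_pair prob_gram_space prob_space_client_sampling prob_space_PiM' prob_PiM_D)

lemma measurable_fedcmoo_round:
  assumes x[measurable]: "x \<in> borel_measurable N" and w[measurable]: "w \<in> borel_measurable N"
    and s: "s \<in> measurable N round_measure"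
  shows "(\<lambda>\<omega>. fst (fedcmoo_round g Q n n' \<tau> \<beta> \<eta>\<^sub>l \<eta>\<^sub>g (s \<omega>) (x \<omega>, w \<omega>))) \<in> borel_measurable N"
    "(\<lambda>\<omega>. snd (fedcmoo_round g Q n n' \<tau> \<beta> \<eta>\<^sub>l \<eta>\<^sub>g (s \<omega>) (x \<omega>, w \<omega>))) \<in> borel_measurable N"
proof -
  have [measurable]: "s \<in> measurable N (gram_measure \<Otimes>\<^sub>M (gram_measure \<Otimes>\<^sub>M (client_sampling n \<Otimes>\<^sub>M local_space \<tau>)))"
    using s by (simp add: round_space_def)
  have [measurable]: "(\<lambda>\<omega>. gram_sketch g Q n' (x \<omega>) (fst (s \<omega>)) $ k) \<in> borel_measurable N" for k
    by (rule measurable_gram_sketch) auto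
  have [measurable]: "(\<lambda>\<omega>. gram_sketch g Q n' (x \<omega>) (fst (snd (s \<omega>))) $ k) \<in> borel_measurable N" for k
    by (rule measurable_gram_sketch) auto
  have [measurable]: "(\<lambda>\<omega>. weight_update \<beta> (gram_mat (gram_sketch g Q n' (x \<omega>) (fst (s \<omega>)))
      (gram_sketch g Q n' (x \<omega>) (fst (snd (s \<omega>))))) (w \<omega>)) \<in> borel_measurable N"
    by (rule measurable_weight_update) auto
  show "(\<lambda>\<omega>. fst (fedcmoo_round g Q n n' \<tau> \<beta> \<eta>\<^sub>l \<eta>\<^sub>g (s \<omega>) (x \<omega>, w \<omega>))) \<in> borel_measurable N"
    "(\<lambda>\<omega>. snd (fedcmoo_round g Q n n' \<tau> \<beta> \<eta>\<^sub>l \<eta>\<^sub>g (s \<omega>) (x \<omega>, w \<omega>))) \<in> borel_measurable N"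
    unfolding fedcmoo_round_eq Let_def fst_conv snd_conv
    by (auto intro!: measurable_server_step)
qed

lemma jac_diff: "jac (w - u) x = jac w x - jac u x"
  by (simp add: scaleR_diff_left sum_subtractf)

text \<open>An estimate conditional on both sketches: \<open>Y\<close> and \<open>Z\<close> are
  arbitrary matrices. Its nonnegativity is inherited from the server step bound, which it
  dominates.\<close>

lemma local_phase_bound:
  fixes Y Z :: "'a ^ 'm" and x :: 'a and w :: "real ^ 'm"
  assumes w: "w \<in> prob_simplex"
  defines "w' \<equiv> weight_update \<beta> (gram_mat Y Z) w"
    and "b \<equiv> opt_gap f x / \<eta> + step_err + (norm (w - uniform_weight))\<^sup>2 / (2 * \<beta>)
      + \<beta> / 2 * (real CARD('m) * C\<^sub>1\<^sup>2) - avg_grad x \<bullet> jac w x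
      - (\<Sum>k\<in>UNIV. (w - uniform_weight) $ k *\<^sub>R Y $ k) \<bullet> (\<Sum>l\<in>UNIV. w $ l *\<^sub>R Z $ l)
      + \<beta> * (\<Sum>k\<in>UNIV. (norm (Y $ k))\<^sup>2) * (\<Sum>l\<in>UNIV. w $ l * (norm (Z $ l))\<^sup>2)"
  shows "0 \<le> b \<and> (\<integral>\<^sup>+y. ennreal (lyapunov (server_step x w' (fst y) (snd y), w'))
    \<partial>(client_sampling n \<Otimes>\<^sub>M local_space \<tau>)) \<le> ennreal b"
proof -
  let ?p = "avg_grad x" and ?u = "uniform_weight :: real ^ 'm" and ?G = "gram_mat Y Z"
  let ?\<kappa> = "(norm (w' - ?u))\<^sup>2 / (2 * \<beta>)"
  \<comment> \<open>The descent term is linear in the weights and equals the inner product with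
    \<open>P\<close>, so passing from \<open>w'\<close> to \<open>w\<close> costs exactly the inner
    product of \<open>w' - w\<close> with \<open>P\<close>.\<close>
  define P :: "real ^ 'm" where "P = (\<chi> k. ?p \<bullet> dF k x)"
  have w': "w' \<in> prob_simplex" unfolding w'_def by (rule weight_update_in_simplex)
  have P: "?p \<bullet> jac v x = v \<bullet> P" for v :: "real ^ 'm"
    by (simp add: P_def inner_vec_def inner_sum_right)
  have "(norm P)\<^sup>2 = (\<Sum>k\<in>UNIV. (?p \<bullet> dF k x)\<^sup>2)"
    by (simp add: power2_norm_eq_inner inner_vec_def P_def) (simp add: power2_eq_square)
  also have "\<dots> \<le> (\<Sum>k\<in>(UNIV :: 'm set). C\<^sub>1\<^sup>2)"
  proof (rule sum_mono)
    fix k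
    have "\<bar>?p \<bullet> dF k x\<bar> \<le> norm ?p * norm (dF k x)" by (rule Cauchy_Schwarz_ineq2)
    also have "\<dots> \<le> B * B" using constants by (intro mult_mono norm_avg_grad norm_grad_F) auto
    also have "\<dots> \<le> C\<^sub>1" using C1_ge by (simp add: power2_eq_square)
    finally have "\<bar>?p \<bullet> dF k x\<bar>\<^sup>2 \<le> C\<^sub>1\<^sup>2" by (intro power_mono) auto
    then show "(?p \<bullet> dF k x)\<^sup>2 \<le> C\<^sub>1\<^sup>2" by simp
  qed
  finally have nP: "(norm P)\<^sup>2 \<le> real CARD('m) * C\<^sub>1\<^sup>2" by simp
  have G: "(w - ?u) \<bullet> (?G *v w)
    = (\<Sum>k\<in>UNIV. (w - ?u) $ k *\<^sub>R Y $ k) \<bullet> (\<Sum>l\<in>UNIV. w $ l *\<^sub>R Z $ l)"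
    by (simp only: inner_vec_def gram_mat_vec inner_sum_left inner_scaleR_left inner_real_def)
  note prog = weight_update_progress[OF w prob_simplex_nonempty rates(3), of ?G P, folded w'_def, unfolded G]
  have "\<beta> * (norm (?G *v w))\<^sup>2 \<le> \<beta> * ((\<Sum>k\<in>UNIV. (norm (Y $ k))\<^sup>2) * (\<Sum>l\<in>UNIV. w $ l * (norm (Z $ l))\<^sup>2))"
    using rates by (intro mult_left_mono gram_mat_vec_norm_sq[OF w]) auto
  moreover have "\<beta> / 2 * (norm P)\<^sup>2 \<le> \<beta> / 2 * (real CARD('m) * C\<^sub>1\<^sup>2)"
    using rates nP by (intro mult_left_mono) auto
  ultimately have "opt_gap f x / \<eta> - ?p \<bullet> jac w' x + step_err + ?\<kappa> \<le> b"
    using prog unfolding b_def P inner_diff_left mult.assoc by linarith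
  moreover have "0 \<le> ?\<kappa>" using rates by simp
  note server_step_expectation[OF w' this, of x]
  ultimately show ?thesis unfolding lyapunov_def fst_conv snd_conv by (meson ennreal_leI order_trans)
qed

text \<open>The bound given both sketches is affine in the second one's linear combination and its
  weighted squared norms, so averaging it needs only first and second moments. The result has the
  same form in the first sketch.\<close>

lemma round_drift:
  fixes x :: 'a and w :: "real ^ 'm"
  assumes w: "w \<in> prob_simplex"
  defines "b \<equiv> lyapunov (x, w) - (norm (jac w x))\<^sup>2 + round_err"
  shows "0 \<le> b \<and> (\<integral>\<^sup>+s. ennreal (lyapunov (fedcmoo_round g Q n n' \<tau> \<beta> \<eta>\<^sub>l \<eta>\<^sub>g s (x, w))) \<partial>round_measure) \<le> ennreal b"
proof -
  interpret GS: prob_space gram_measure by (rule prob_gram_space)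
  interpret PS: prob_space "client_sampling n \<Otimes>\<^sub>M local_space \<tau>"
    by (intro prob_space_pair prob_space_client_sampling prob_space_PiM' prob_PiM_D)
  interpret GPS: prob_space "gram_measure \<Otimes>\<^sub>M (client_sampling n \<Otimes>\<^sub>M local_space \<tau>)"
    by (intro prob_space_pair prob_gram_space prob_space_client_sampling prob_space_PiM' prob_PiM_D)
  let ?Y = "gram_sketch g Q n' x :: ('n, 'm, 's, 'c) gram_seed \<Rightarrow> 'a ^ 'm" and ?u = "uniform_weight :: real ^ 'm"
  let ?I = "\<lambda>s1 s2. \<integral>\<^sup>+y. ennreal (lyapunov (fedcmoo_round g Q n n' \<tau> \<beta> \<eta>\<^sub>l \<eta>\<^sub>g (s1, s2, y) (x, w)))
      \<partial>(client_sampling n \<Otimes>\<^sub>M local_space \<tau>)"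
  define K where "K = opt_gap f x / \<eta> + step_err + (norm (w - ?u))\<^sup>2 / (2 * \<beta>)
      + \<beta> / 2 * (real CARD('m) * C\<^sub>1\<^sup>2) - avg_grad x \<bullet> jac w x"
  have [measurable]: "(\<lambda>s. fedcmoo_round g Q n n' \<tau> \<beta> \<eta>\<^sub>l \<eta>\<^sub>g s (x, w)) \<in> borel_measurable round_measure"
    using borel_measurable_Pair[OF measurable_fedcmoo_round[of "\<lambda>_. x" round_measure "\<lambda>_. w" "\<lambda>s. s"]] by simp
  have [measurable]: "lyapunov \<in> borel_measurable borel"
    unfolding lyapunov_def[abs_def] borel_prod[symmetric] by measurable
  have m[measurable]: "(\<lambda>s. ennreal (lyapunov (fedcmoo_round g Q n n' \<tau> \<beta> \<eta>\<^sub>l \<eta>\<^sub>g s (x, w))))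
    \<in> borel_measurable (gram_measure \<Otimes>\<^sub>M (gram_measure \<Otimes>\<^sub>M (client_sampling n \<Otimes>\<^sub>M local_space \<tau>)))"
    unfolding round_space_def[symmetric] by measurable
  have split: "(\<integral>\<^sup>+s. ennreal (lyapunov (fedcmoo_round g Q n n' \<tau> \<beta> \<eta>\<^sub>l \<eta>\<^sub>g s (x, w))) \<partial>round_measure)
    = (\<integral>\<^sup>+s1. \<integral>\<^sup>+s2. ?I s1 s2 \<partial>gram_measure \<partial>gram_measure)"
  proof -
    have "(\<integral>\<^sup>+s. ennreal (lyapunov (fedcmoo_round g Q n n' \<tau> \<beta> \<eta>\<^sub>l \<eta>\<^sub>g s (x, w))) \<partial>round_measure)
      = (\<integral>\<^sup>+s1. \<integral>\<^sup>+y. ennreal (lyapunov (fedcmoo_round g Q n n' \<tau> \<beta> \<eta>\<^sub>l \<eta>\<^sub>g (s1, y) (x, w)))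
          \<partial>(gram_measure \<Otimes>\<^sub>M (client_sampling n \<Otimes>\<^sub>M local_space \<tau>)) \<partial>gram_measure)"
      unfolding round_space_def by (rule GPS.nn_integral_fst[OF m, symmetric])
    also have "\<dots> = (\<integral>\<^sup>+s1. \<integral>\<^sup>+s2. ?I s1 s2 \<partial>gram_measure \<partial>gram_measure)"
      by (intro nn_integral_cong PS.nn_integral_fst[symmetric]) (rule measurable_compose_Pair1[OF _ m], simp)
    finally show ?thesis .
  qed
  note mom = gram_sketch_moments[where x = x]
  have i1: "integrable gram_measure (\<lambda>s. \<Sum>k\<in>UNIV. v $ k *\<^sub>R ?Y s $ k)"
    and e1: "(\<integral>s. (\<Sum>k\<in>UNIV. v $ k *\<^sub>R ?Y s $ k) \<partial>gram_measure) = jac v x" for v :: "real ^ 'm"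
    using mom by simp_all
  have i2: "integrable gram_measure (\<lambda>s. \<Sum>k\<in>UNIV. v k * (norm (?Y s $ k))\<^sup>2)" for v :: "'m \<Rightarrow> real"
    using mom by simp
  have e2: "(\<integral>s. (\<Sum>k\<in>UNIV. v k * (norm (?Y s $ k))\<^sup>2) \<partial>gram_measure) \<le> (\<Sum>k\<in>UNIV. v k) * C\<^sub>1"
    if "\<And>k. 0 \<le> v k" for v :: "'m \<Rightarrow> real"
  proof -
    have "(\<integral>s. (\<Sum>k\<in>UNIV. v k * (norm (?Y s $ k))\<^sup>2) \<partial>gram_measure)
      = (\<Sum>k\<in>UNIV. v k * (\<integral>s. (norm (?Y s $ k))\<^sup>2 \<partial>gram_measure))" using mom by simp
    also have "\<dots> \<le> (\<Sum>k\<in>UNIV. v k * C\<^sub>1)" by (intro sum_mono mult_left_mono mom that)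
    finally show ?thesis by (simp add: sum_distrib_right)
  qed
  have C1: "0 \<le> C\<^sub>1" using C1_ge zero_le_power2[of B] by linarith
  let ?a = "\<lambda>s. \<Sum>k\<in>UNIV. (w - ?u) $ k *\<^sub>R ?Y s $ k" and ?z = "\<lambda>s. \<Sum>l\<in>UNIV. w $ l *\<^sub>R ?Y s $ l"
  let ?r = "\<lambda>s. \<Sum>k\<in>UNIV. (norm (?Y s $ k))\<^sup>2" and ?t = "\<lambda>s. \<Sum>l\<in>UNIV. w $ l * (norm (?Y s $ l))\<^sup>2"
  have affine: "integrable gram_measure (\<lambda>s. c - p \<bullet> S s + d * R s)"
    "(\<integral>s. c - p \<bullet> S s + d * R s \<partial>gram_measure)
      = c - p \<bullet> (\<integral>s. S s \<partial>gram_measure) + d * (\<integral>s. R s \<partial>gram_measure)"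
    if "integrable gram_measure S" "integrable gram_measure R" for c d :: real and p :: 'a and S R
    using that by (simp_all add: GS.prob_space)
  have rt: "(\<integral>s. ?r s \<partial>gram_measure) \<le> real CARD('m) * C\<^sub>1" "integrable gram_measure ?r"
    using e2[of "\<lambda>_. 1"] i2[of "\<lambda>_. 1"] by simp_all
  have tt: "(\<integral>s. ?t s \<partial>gram_measure) \<le> C\<^sub>1"
    using e2[of "\<lambda>l. w $ l"] prob_simplexD[OF w] by simp
  \<comment> \<open>With the first sketch fixed, \<open>?z\<close> averages to
    \<open>jac w x\<close>, and \<open>?t\<close>, a convex combination, has mean at most
    \<open>C\<^sub>1\<close>. The unweighted \<open>?r\<close> of the first sketch supplies
    \<open>CARD('m) * C\<^sub>1\<close> at the outer level.\<close>
  have lvl2: "0 \<le> K - jac w x \<bullet> ?a s1 + \<beta> * C\<^sub>1 * ?r s1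
      \<and> (\<integral>\<^sup>+s2. ?I s1 s2 \<partial>gram_measure) \<le> ennreal (K - jac w x \<bullet> ?a s1 + \<beta> * C\<^sub>1 * ?r s1)" for s1
  proof -
    let ?H = "\<lambda>s2. K - ?a s1 \<bullet> ?z s2 + \<beta> * ?r s1 * ?t s2"
    have "0 \<le> (\<integral>s2. ?H s2 \<partial>gram_measure) \<and> (\<integral>\<^sup>+s2. ?I s1 s2 \<partial>gram_measure) \<le> ennreal (\<integral>s2. ?H s2 \<partial>gram_measure)"
    proof (rule nn_integral_le_integral[OF affine(1)[OF i1 i2]])
      fix s2
      have eq: "?I s1 s2 = (\<integral>\<^sup>+y. ennreal (lyapunov (server_step x (weight_update \<beta> (gram_mat (?Y s1) (?Y s2)) w) (fst y) (snd y),
          weight_update \<beta> (gram_mat (?Y s1) (?Y s2)) w)) \<partial>(client_sampling n \<Otimes>\<^sub>M local_space \<tau>))"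
        unfolding fedcmoo_round_eq Let_def fst_conv snd_conv ..
      show "0 \<le> ?H s2 \<and> ?I s1 s2 \<le> ennreal (?H s2)"
        unfolding eq K_def by (rule local_phase_bound[OF w])
    qed
    moreover have "(\<integral>s2. ?H s2 \<partial>gram_measure) \<le> K - jac w x \<bullet> ?a s1 + \<beta> * C\<^sub>1 * ?r s1"
    proof -
      have "(\<integral>s2. ?H s2 \<partial>gram_measure) = K - ?a s1 \<bullet> jac w x + \<beta> * ?r s1 * (\<integral>s. ?t s \<partial>gram_measure)"
        unfolding affine(2)[OF i1 i2] e1 ..
      also have "\<dots> \<le> K - ?a s1 \<bullet> jac w x + \<beta> * ?r s1 * C\<^sub>1"
        using rates by (intro add_left_mono mult_left_mono tt mult_nonneg_nonneg sum_nonneg) auto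
      finally show ?thesis by (simp only: inner_commute mult_ac)
    qed
    ultimately show ?thesis by (meson ennreal_leI order_trans)
  qed
  have "0 \<le> (\<integral>s1. K - jac w x \<bullet> ?a s1 + \<beta> * C\<^sub>1 * ?r s1 \<partial>gram_measure) \<and>
     (\<integral>\<^sup>+s1. \<integral>\<^sup>+s2. ?I s1 s2 \<partial>gram_measure \<partial>gram_measure)
       \<le> ennreal (\<integral>s1. K - jac w x \<bullet> ?a s1 + \<beta> * C\<^sub>1 * ?r s1 \<partial>gram_measure)"
    by (rule nn_integral_le_integral[OF affine(1)[OF i1 rt(2)] lvl2])
  moreover have "(\<integral>s1. K - jac w x \<bullet> ?a s1 + \<beta> * C\<^sub>1 * ?r s1 \<partial>gram_measure) \<le> b"
  proof -
    have "(\<integral>s1. K - jac w x \<bullet> ?a s1 + \<beta> * C\<^sub>1 * ?r s1 \<partial>gram_measure)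
      = K - jac w x \<bullet> jac (w - ?u) x + \<beta> * C\<^sub>1 * (\<integral>s. ?r s \<partial>gram_measure)"
      unfolding affine(2)[OF i1 rt(2)] e1 ..
    also have "\<dots> \<le> K - jac w x \<bullet> jac (w - ?u) x + \<beta> * C\<^sub>1 * (real CARD('m) * C\<^sub>1)"
      using rates C1 by (intro add_left_mono mult_left_mono rt) auto
    also have "\<dots> = b"
    proof -
      \<comment> \<open>The term with \<open>avg_grad x\<close> cancels the one left in
        \<open>K\<close> by the descent step.\<close>
      have "jac w x \<bullet> jac (w - ?u) x = (norm (jac w x))\<^sup>2 - avg_grad x \<bullet> jac w x"
        unfolding jac_diff inner_diff_right power2_norm_eq_inner by (simp only: inner_commute)
      moreover have "\<beta> * C\<^sub>1 * (real CARD('m) * C\<^sub>1) = \<beta> * (real CARD('m) * C\<^sub>1\<^sup>2)"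
        by (simp add: power2_eq_square)
      ultimately show ?thesis
        unfolding b_def K_def lyapunov_def round_err_def fst_conv snd_conv by simp
    qed
    finally show ?thesis .
  qed
  ultimately show ?thesis unfolding split by (meson ennreal_leI order_trans)
qed

section \<open>The iterates over all rounds\<close>

abbreviation "run x0 t \<omega> \<equiv> fedcmoo g Q n n' \<tau> \<beta> \<eta>\<^sub>l \<eta>\<^sub>g x0 \<omega> t"

lemma run_weight_in_simplex: "snd (run x0 t \<omega>) \<in> prob_simplex"
proof (cases t)
  case (Suc s)
  then show ?thesis
    by (cases "run x0 s \<omega>") (simp add: fedcmoo_round_eq Let_def weight_update_in_simplex)
qed (simp add: prob_simplex_nonempty)

lemma run_upd: "t \<le> i \<Longrightarrow> run x0 t (u(i := y)) = run x0 t u"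
  by (induction t) auto

lemma measurable_run:
  assumes "t \<le> T"
  shows "(\<lambda>\<omega>. fst (run x0 t \<omega>)) \<in> borel_measurable (PiM {..<T} (\<lambda>_. round_measure)) \<and>
    (\<lambda>\<omega>. snd (run x0 t \<omega>)) \<in> borel_measurable (PiM {..<T} (\<lambda>_. round_measure))"
  using assms
proof (induction t)
  case (Suc t)
  have s: "(\<lambda>\<omega>. \<omega> t) \<in> measurable (PiM {..<T} (\<lambda>_. round_measure)) round_measure"
    using Suc.prems by (intro measurable_component_singleton) auto
  show ?case
    using Suc measurable_fedcmoo_round[OF _ _ s, of "\<lambda>\<omega>. fst (run x0 t \<omega>)" "\<lambda>\<omega>. snd (run x0 t \<omega>)"]
    by simp
qed simp

lemma average_stationarity:
  "(\<Sum>t<T. \<integral>\<omega>. (norm (jac (snd (run x0 t \<omega>)) (fst (run x0 t \<omega>))))\<^sup>2 \<partial>(run_space D C n n' \<tau> T))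
    \<le> opt_gap f x0 / \<eta> + real T * round_err"
proof -
  let ?R = "run_space D C n n' \<tau> T :: (nat \<Rightarrow> ('n, 'm, 's, 'c) round_seed) measure"
  let ?h = "\<lambda>t \<omega>. (norm (jac (snd (run x0 t \<omega>)) (fst (run x0 t \<omega>))))\<^sup>2"
  interpret R: prob_space ?R
    unfolding run_space_def by (intro prob_space_PiM' prob_round_space)
  have m: "(\<lambda>\<omega>. ennreal (lyapunov (run x0 t \<omega>))) \<in> borel_measurable (PiM {..<T'} (\<lambda>_. round_measure))"
    "?h t \<in> borel_measurable (PiM {..<T'} (\<lambda>_. round_measure))" if "t \<le> T'" for t T'
  proof -
    note [measurable] = measurable_run[OF that, of x0, THEN conjunct1] measurable_run[OF that, of x0, THEN conjunct2]
    show "(\<lambda>\<omega>. ennreal (lyapunov (run x0 t \<omega>))) \<in> borel_measurable (PiM {..<T'} (\<lambda>_. round_measure))"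
      unfolding lyapunov_def by measurable
    show "?h t \<in> borel_measurable (PiM {..<T'} (\<lambda>_. round_measure))" by measurable
  qed
  \<comment> \<open>The uniform bound makes the stationarity terms integrable, so the
    \<open>ennreal\<close> estimate can be turned into one for expectations.\<close>
  have h: "0 \<le> ?h t \<omega>" "?h t \<omega> \<le> B\<^sup>2" for t \<omega>
    using norm_simplex_sum_le[OF run_weight_in_simplex norm_grad_F] by (auto intro!: power_mono)
  have drift: "(\<integral>\<^sup>+y. ennreal (lyapunov (run x0 (Suc t) (u(t := y)))) \<partial>round_measure) + ennreal (?h t u)
      \<le> ennreal (lyapunov (run x0 t u)) + ennreal round_err" for t u
  proof -
    obtain x w where xw: "run x0 t u = (x, w)" by force
    have w: "w \<in> prob_simplex" using run_weight_in_simplex[of x0 u t] xw by simp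
    from round_drift[OF w, of x]
    have "0 \<le> lyapunov (x, w) - (norm (jac w x))\<^sup>2 + round_err"
      and le: "(\<integral>\<^sup>+s. ennreal (lyapunov (fedcmoo_round g Q n n' \<tau> \<beta> \<eta>\<^sub>l \<eta>\<^sub>g s (x, w))) \<partial>round_measure)
        \<le> ennreal (lyapunov (x, w) - (norm (jac w x))\<^sup>2 + round_err)" by auto
    \<comment> \<open>Moving the squared norm to the other side is valid in \<open>ennreal\<close>
      because the difference is known to be nonnegative.\<close>
    then have "ennreal (lyapunov (x, w) - (norm (jac w x))\<^sup>2 + round_err) + ennreal ((norm (jac w x))\<^sup>2)
        = ennreal (lyapunov (x, w)) + ennreal round_err"
      using lyapunov_nonneg round_err_nonneg by (simp add: ennreal_plus[symmetric] del: ennreal_plus)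
    with add_right_mono[OF le, of "ennreal ((norm (jac w x))\<^sup>2)"] show ?thesis
      by (simp add: run_upd xw)
  qed
  have "(\<integral>\<^sup>+\<omega>. ennreal (lyapunov (run x0 T \<omega>)) + (\<Sum>j<T. ennreal (?h j \<omega>)) \<partial>?R)
      \<le> ennreal (lyapunov (run x0 0 (\<lambda>_. undefined))) + of_nat T * ennreal round_err"
    unfolding run_space_def
  proof (rule nn_integral_PiM_drift[OF prob_round_space])
    fix t i u y assume "t \<le> (i::nat)"
    then show "ennreal (lyapunov (run x0 t (u(i := y)))) = ennreal (lyapunov (run x0 t u))"
      "ennreal (?h t (u(i := y))) = ennreal (?h t u)" by (simp_all only: run_upd)
  next
    fix t u
    show "(\<integral>\<^sup>+y. ennreal (lyapunov (run x0 (Suc t) (u(t := y)))) \<partial>round_measure) + ennreal (?h t u)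
      \<le> ennreal (lyapunov (run x0 t u)) + ennreal round_err" by (rule drift)
  next
    fix t T' :: nat assume "t \<le> T'"
    from m[OF this] show "(\<lambda>\<omega>. ennreal (lyapunov (run x0 t \<omega>))) \<in> borel_measurable (PiM {..<T'} (\<lambda>_. round_measure))"
      "(\<lambda>\<omega>. ennreal (?h t \<omega>)) \<in> borel_measurable (PiM {..<T'} (\<lambda>_. round_measure))" by simp_all
  qed simp
  \<comment> \<open>The initial weight is uniform, so the quadratic part of the initial potential is
    0.\<close>
  also have "\<dots> = ennreal (opt_gap f x0 / \<eta> + real T * round_err)"
    using opt_gap_nonneg eta_pos round_err_nonneg
    by (simp add: lyapunov_def ennreal_of_nat_eq_real_of_nat ennreal_mult[symmetric])
  finally have bound: "(\<integral>\<^sup>+\<omega>. ennreal (lyapunov (run x0 T \<omega>)) + (\<Sum>j<T. ennreal (?h j \<omega>)) \<partial>?R)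
      \<le> ennreal (opt_gap f x0 / \<eta> + real T * round_err)" .
  have i: "integrable ?R (?h t)" if "t < T" for t
    by (rule R.integrable_const_bound[where B = "B\<^sup>2"])
      (use h m that in \<open>auto simp: run_space_def\<close>)
  have "ennreal (\<Sum>t<T. \<integral>\<omega>. ?h t \<omega> \<partial>?R) = ennreal (\<integral>\<omega>. (\<Sum>t<T. ?h t \<omega>) \<partial>?R)"
    using i by (subst Bochner_Integration.integral_sum) auto
  also have "\<dots> = (\<integral>\<^sup>+\<omega>. ennreal (\<Sum>t<T. ?h t \<omega>) \<partial>?R)"
    using i by (intro nn_integral_eq_integral[symmetric]) (auto intro!: sum_nonneg)
  also have "\<dots> \<le> (\<integral>\<^sup>+\<omega>. ennreal (lyapunov (run x0 T \<omega>)) + (\<Sum>j<T. ennreal (?h j \<omega>)) \<partial>?R)"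
    by (intro nn_integral_mono) (simp add: sum_ennreal)
  also note bound
  finally show ?thesis
    using opt_gap_nonneg eta_pos round_err_nonneg by (subst (asm) ennreal_le_iff) auto
qed

end

theorem theorem1:
  fixes f :: "'n::finite \<Rightarrow> 'm::finite \<Rightarrow> 'a::euclidean_space \<Rightarrow> real"
    and g :: "'n \<Rightarrow> 'm \<Rightarrow> 'a \<Rightarrow> 's \<Rightarrow> 'a" and D :: "'n \<Rightarrow> 's measure"
    and Q :: "'a \<Rightarrow> 'c \<Rightarrow> 'a" and C :: "'c measure"
    and L \<sigma> \<sigma>\<^sub>g B q \<eta>\<^sub>l \<eta>\<^sub>g \<beta> :: real
    and n n' \<tau> T :: nat
    and x0 :: 'a
  assumes clients: "CARD('n) \<ge> 2"
    and sizes: "1 \<le> n" "n \<le> CARD('n)" "1 \<le> n'" "n' \<le> CARD('n)"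
    and rounds: "1 \<le> T" "1 \<le> \<tau>"
    and constants: "0 \<le> L" "0 \<le> \<sigma>" "0 \<le> \<sigma>\<^sub>g" "0 < B" "0 < q"
    \<comment> \<open>for \<open>L > 0\<close>, this is \<open>\<eta>\<^sub>l \<le> 1 / (2 L \<tau>)\<close>\<close>
    and rates: "0 < \<eta>\<^sub>l" "2 * L * real \<tau> * \<eta>\<^sub>l \<le> 1" "0 < \<eta>\<^sub>g" "0 < \<beta>"
    and differentiable: "\<And>i k x. f i k differentiable (at x)"
    and bounded_below: "\<And>k. bdd_below (range (global_obj f k))"
    and prob_D: "\<And>i. prob_space (D i)"
    and prob_C: "prob_space C"
    and meas_g: "\<And>i k. (\<lambda>(x, s). g i k x s) \<in> borel_measurable (borel \<Otimes>\<^sub>M D i)"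
    and meas_Q: "(\<lambda>(x, c). Q x c) \<in> borel_measurable (borel \<Otimes>\<^sub>M C)"
    and A1: "\<And>i k x x'. norm (grad (f i k) x - grad (f i k) x') \<le> L * norm (x - x')"
    and A2_mean: "\<And>i k x. integrable (D i) (g i k x)"
                 "\<And>i k x. (\<integral>s. g i k x s \<partial>D i) = grad (f i k) x"
    and A2_var: "\<And>i k x. integrable (D i) (\<lambda>s. (norm (g i k x s - grad (f i k) x))\<^sup>2)"
                "\<And>i k x. (\<integral>s. (norm (g i k x s - grad (f i k) x))\<^sup>2 \<partial>D i) \<le> \<sigma>\<^sup>2"
    and A3: "\<And>k x. (1 / real CARD('n)) *
               (\<Sum>i\<in>UNIV. (norm (grad (f i k) x - grad (global_obj f k) x))\<^sup>2) \<le> \<sigma>\<^sub>g\<^sup>2"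
    and A4: "\<And>i k x. norm (grad (f i k) x) \<le> B"
    and A5_mean: "\<And>x. integrable C (Q x)"
                 "\<And>x. (\<integral>c. Q x c \<partial>C) = x"
    and A5_var: "\<And>x. integrable C (\<lambda>c. (norm (Q x c - x))\<^sup>2)"
                "\<And>x. (\<integral>c. (norm (Q x c - x))\<^sup>2 \<partial>C) \<le> q * (norm x)\<^sup>2"
  defines "C\<^sub>1 \<equiv> C1_const CARD('n) n' q \<sigma> \<sigma>\<^sub>g B"
    and "K \<equiv> O_const (opt_gap f x0)"
    and "X \<equiv> \<lambda>t \<omega>. fst (fedcmoo g Q n n' \<tau> \<beta> \<eta>\<^sub>l \<eta>\<^sub>g x0 \<omega> t)"
    and "W \<equiv> \<lambda>t \<omega>. snd (fedcmoo g Q n n' \<tau> \<beta> \<eta>\<^sub>l \<eta>\<^sub>g x0 \<omega> t)"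
  shows "(1 / real T) * (\<Sum>t<T.
           \<integral>\<omega>. (norm (\<Sum>k\<in>UNIV. W t \<omega> $ k *\<^sub>R grad (global_obj f k) (X t \<omega>)))\<^sup>2
             \<partial>(run_space D C n n' \<tau> T))
         \<le> K * (\<beta> * real CARD('m) * C\<^sub>1\<^sup>2)
           + K * (1 / (real T * \<eta>\<^sub>g * \<eta>\<^sub>l * real \<tau>) + L * \<eta>\<^sub>g * \<eta>\<^sub>l * \<sigma>\<^sup>2 / real n)
           + K * (L * \<eta>\<^sub>g * \<eta>\<^sub>l * real \<tau> * B\<^sup>2)
           + K * (L * \<eta>\<^sub>l * (real \<tau> * B\<^sup>2 + sqrt (real \<tau>) * B * \<sigma>))"
proof -
  interpret S: fedcmoo_setting f g D Q C L \<sigma> \<sigma>\<^sub>g B q \<eta>\<^sub>l \<eta>\<^sub>g \<beta> C\<^sub>1 n n' \<tau>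
    using clients sizes rounds(2) constants rates(1,3,4) differentiable bounded_below prob_D prob_C
      meas_g meas_Q A1 A2_mean A2_var A3 A4 A5_mean A5_var
    by (intro fedcmoo_setting.intro) (simp_all only: C\<^sub>1_def)
  let ?\<delta> = "opt_gap f x0" and ?h = "\<eta>\<^sub>g * \<eta>\<^sub>l * real \<tau>"
  let ?a = "\<beta> * real CARD('m) * C\<^sub>1\<^sup>2" and ?b = "1 / (real T * \<eta>\<^sub>g * \<eta>\<^sub>l * real \<tau>)"
    and ?c = "L * \<eta>\<^sub>g * \<eta>\<^sub>l * \<sigma>\<^sup>2 / real n" and ?d = "L * \<eta>\<^sub>g * \<eta>\<^sub>l * real \<tau> * B\<^sup>2"
    and ?e = "L * \<eta>\<^sub>l * (real \<tau> * B\<^sup>2 + sqrt (real \<tau>) * B * \<sigma>)"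
  have \<delta>: "0 \<le> ?\<delta>" by (rule S.opt_gap_nonneg)
  have K: "K = 10 + 10 * ?\<delta>" by (simp add: K_def O_const_def)
  have pos: "0 \<le> ?a" "0 \<le> ?b" "0 \<le> ?c" "0 \<le> ?d" "0 \<le> ?e"
    using rates constants by simp_all
  have "(1 / real T) * (\<Sum>t<T.
      \<integral>\<omega>. (norm (\<Sum>k\<in>UNIV. W t \<omega> $ k *\<^sub>R grad (global_obj f k) (X t \<omega>)))\<^sup>2 \<partial>(run_space D C n n' \<tau> T))
    \<le> (1 / real T) * (?\<delta> / ?h + real T * S.round_err)"
    unfolding W_def X_def by (intro mult_left_mono S.average_stationarity) simp
  also have "\<dots> = ?\<delta> * ?b + S.round_err"
    using rounds by (simp add: distrib_left)
  \<comment> \<open>In the variance term, the \<open>\<tau>\<close> inside \<open>\<eta>\<close>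
    cancels the one in the denominator.\<close>
  also have "S.round_err = 3 / 2 * ?a + ?c + ?d + ?e"
    using rounds sizes by (simp add: S.round_err_def S.step_err_def algebra_simps power2_eq_square)
  also have "?\<delta> * ?b + (3 / 2 * ?a + ?c + ?d + ?e) \<le> K * ?a + K * (?b + ?c) + K * ?d + K * ?e"
  proof -
    \<comment> \<open>The actual coefficients are \<open>?\<delta>\<close>, \<open>3 / 2\<close> and
      1; as \<open>?\<delta>\<close> is nonnegative, \<open>K\<close> dominates each of
      them.\<close>
    have "?\<delta> * ?b \<le> K * ?b" "3 / 2 * ?a \<le> K * ?a" "1 * ?c \<le> K * ?c" "1 * ?d \<le> K * ?d" "1 * ?e \<le> K * ?e"
      by (intro mult_right_mono pos; use \<delta> K in linarith)+
    then show ?thesis unfolding distrib_left[of K ?b ?c] by linarith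
  qed
  finally show ?thesis .
qed

end
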